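(* Let $\mathcal D\subseteq\mathbb R^n$ be a domain, $x^*\in\mathcal D$, and let $J\in C^2(\mathcal D;\mathbb R)$ satisfy: (i) $J(x)>J(x^* )$ for all $x\in\mathcal D\setminus\{x^*\}$; (ii) for $x\in\mathcal D$, $\nabla J(x)=0$ if and only if $x=x^*$. Let $\phi_1,\phi_2,\psi_{11},\psi_{12},\psi_{21},\psi_{22}\in C^2(\mathbb R;\mathbb R)$ satisfy $[\phi_1,\phi_2]\equiv-1$ (that is, $\phi_1\phi_2'-\phi_1'\phi_2\equiv-1$) and $\psi_{11}\psi_{21}'+\psi_{12}\psi_{22}'\equiv1$ on $\mathbb R$. Let $\epsilon>0$, $\alpha_i,\beta_i>0$ $(i=1,\dots,n)$, and let $\kappa_i,\varkappa_{i1},\varkappa_{i2}\in\mathbb N$, $i=1,\dots,n$, be pairwise distinct ($3n$ distinct numbers). Consider, for the frequency parameter $\omega>0$, the system with state $\bar q=(\bar x^\top,\bar v^\top)^\top\in\mathbb R^{2n}$: $$\begin{aligned} \dot{\bar x}_i={}&\sqrt{2\alpha_i\kappa_i\omega}\Big(\phi_1\Big(\tfrac{J(\bar x)}{\sqrt{\bar v_i^2+\epsilon}}\Big)\cos(\kappa_i\omega t)+\phi_2\Big(\tfrac{J(\bar x)}{\sqrt{\bar v_i^2+\epsilon}}\Big)\sin(\kappa_i\omega t)\Big)\\ &+\sqrt{2\beta_i\omega}\Big(\sqrt{\varkappa_{i1}}\,\psi_{11}(J(\bar x))\cos(\varkappa_{i1}\omega t)+\sqrt{\varkappa_{i2}}\,\psi_{12}(J(\bar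 x))\cos(\varkappa_{i2}\omega t)\Big),\\ \dot{\bar v}_i={}&-\beta_i\bar v_i+\sqrt{2\beta_i\omega}\Big(\sqrt{\varkappa_{i1}}\,\psi_{21}(J(\bar x))\sin(\varkappa_{i1}\omega t)+\sqrt{\varkappa_{i2}}\,\psi_{22}(J(\bar x))\sin(\varkappa_{i2}\omega t)\Big), \end{aligned}$$ $i=1,\dots,n$. Then the point $q^*=({x^*}^\top,0^\top)^\top$ is practically uniformly asymptotically stable for this system.
   Context: Notation: $\nabla J$ is the gradient of $J$. For scalar functions of one variable, $[f,g]=fg'-f'g$. The system is considered for $\bar x\in\mathcal D$, $\bar v\in\mathbb R^n$. Practical uniform asymptotic stability (the frequency $\omega$ being the parameter) of $q^*$ means that both of the following hold. (1) Practical uniform stability: for every $\varepsilon>0$ there exist $\delta>0$ and $\omega_0>0$ such that for all $\omega>\omega_0$ and all initial times $t_0\ge 0$, every solution with $\|\bar q(t_0)-q^*\|<\delta$ exists for all $t\ge t_0$ and satisfies $\|\bar q(t)-q^*\|<\varepsilon$ for all $t\ge t_0$. (2) Practical uniform attractivity: there exists $\delta>0$ such that for every $\varepsilon>0$ there exist $t_f\ge0$ and $\omega_0>0$ such that for all $\omega>\omega_0$ and all $t_0\ge0$, every solution with $\|\bar q(t_0)-q^*\|<\delta$ exists for all $t\ge t_0$ and satisfies $\|\bar q(t)-q^*\|<\varepsilon$ for all $t\ge t_0+t_f$. *)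

theory Defs
  imports "HOL-Analysis.Analysis"
begin

text \<open>\<open>C\<^sup>2\<close> in the Frechet sense, as a map on an open set.\<close>

definition C2_on :: "('a::real_normed_vector \<Rightarrow> real) \<Rightarrow> 'a set \<Rightarrow> bool" where
  "C2_on f S \<longleftrightarrow> open S \<and>
     (\<exists>(f' :: 'a \<Rightarrow> 'a \<Rightarrow>\<^sub>L real) (f'' :: 'a \<Rightarrow> 'a \<Rightarrow>\<^sub>L ('a \<Rightarrow>\<^sub>L real)).
        (\<forall>x\<in>S. (f has_derivative blinfun_apply (f' x)) (at x)) \<and>
        (\<forall>x\<in>S. (f' has_derivative blinfun_apply (f'' x)) (at x)) \<and>
        continuous_on S f'')"

definition lie_bracket :: "(real \<Rightarrow> real) \<Rightarrow> (real \<Rightarrow> real) \<Rightarrow> real \<Rightarrow> real" where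
  "lie_bracket f g y = f y * deriv g y - deriv f y * g y"

text \<open>
  Forward solutions of \<open>q' = F t q\<close> with values in \<open>U\<close>, on an interval \<open>I\<close> whose least
  element is \<open>t0\<close> (so \<open>I\<close> is \<open>[t0, T)\<close>, \<open>[t0, T]\<close> or \<open>[t0, \<infinity>)\<close>). Only the values
  of \<open>q\<close> on \<open>I\<close> matter. The degenerate interval \<open>{t0}\<close> is admitted on purpose: every initial
  value in \<open>U\<close> then starts at least one maximal solution, and if no proper solution
  starts there, the maximal one is not defined for all \<open>t \<ge> t0\<close>.
\<close>

definition solution_on ::
    "(real \<Rightarrow> 'a::real_normed_vector \<Rightarrow> 'a) \<Rightarrow> 'a set \<Rightarrow> real \<Rightarrow> real set \<Rightarrow> (real \<Rightarrow> 'a) \<Rightarrow> bool" where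
  "solution_on F U t0 I q \<longleftrightarrow>
     is_interval I \<and> t0 \<in> I \<and> I \<subseteq> {t0..} \<and> q ` I \<subseteq> U \<and>
     (\<forall>t\<in>I. (q has_vector_derivative F t (q t)) (at t within I))"

definition maximal_solution_on ::
    "(real \<Rightarrow> 'a::real_normed_vector \<Rightarrow> 'a) \<Rightarrow> 'a set \<Rightarrow> real \<Rightarrow> real set \<Rightarrow> (real \<Rightarrow> 'a) \<Rightarrow> bool" where
  "maximal_solution_on F U t0 I q \<longleftrightarrow>
     solution_on F U t0 I q \<and>
     \<not> (\<exists>I' q'. I \<subset> I' \<and> solution_on F U t0 I' q' \<and> (\<forall>t\<in>I. q' t = q t))"

text \<open>
  In the following, \<open>F \<omega>\<close> is the right-hand side for frequency \<open>\<omega>\<close>. That every solution exists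
  for all \<open>t \<ge> t0\<close> is expressed by requiring maximal solutions to have domain \<open>{t0..}\<close>.
\<close>

definition practically_uniformly_stable ::
    "(real \<Rightarrow> real \<Rightarrow> 'a::real_normed_vector \<Rightarrow> 'a) \<Rightarrow> 'a set \<Rightarrow> 'a \<Rightarrow> bool" where
  "practically_uniformly_stable F U qs \<longleftrightarrow>
     (\<forall>\<epsilon>>0. \<exists>\<delta>>0. \<exists>\<omega>0>0. \<forall>\<omega>>\<omega>0. \<forall>t0\<ge>0. \<forall>I q.
        maximal_solution_on (F \<omega>) U t0 I q \<and> norm (q t0 - qs) < \<delta> \<longrightarrow>
          I = {t0..} \<and> (\<forall>t\<ge>t0. norm (q t - qs) < \<epsilon>))"

definition practically_uniformly_attractive ::
    "(real \<Rightarrow> real \<Rightarrow> 'a::real_normed_vector \<Rightarrow> 'a) \<Rightarrow> 'a set \<Rightarrow> 'a \<Rightarrow> bool" where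
  "practically_uniformly_attractive F U qs \<longleftrightarrow>
     (\<exists>\<delta>>0. \<forall>\<epsilon>>0. \<exists>tf\<ge>0. \<exists>\<omega>0>0. \<forall>\<omega>>\<omega>0. \<forall>t0\<ge>0. \<forall>I q.
        maximal_solution_on (F \<omega>) U t0 I q \<and> norm (q t0 - qs) < \<delta> \<longrightarrow>
          I = {t0..} \<and> (\<forall>t\<ge>t0 + tf. norm (q t - qs) < \<epsilon>))"

definition practically_uniformly_asymptotically_stable ::
    "(real \<Rightarrow> real \<Rightarrow> 'a::real_normed_vector \<Rightarrow> 'a) \<Rightarrow> 'a set \<Rightarrow> 'a \<Rightarrow> bool" where
  "practically_uniformly_asymptotically_stable F U qs \<longleftrightarrow>
     practically_uniformly_stable F U qs \<and> practically_uniformly_attractive F U qs"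

text \<open>
  The state \<open>(x, v)\<close> lives in the product space, whose norm is the Euclidean norm of the
  stacked vector of dimension \<open>2 * CARD('n)\<close>.
\<close>

definition es_field ::
    "(real \<Rightarrow> real) \<Rightarrow> (real \<Rightarrow> real) \<Rightarrow>
     (real \<Rightarrow> real) \<Rightarrow> (real \<Rightarrow> real) \<Rightarrow> (real \<Rightarrow> real) \<Rightarrow> (real \<Rightarrow> real) \<Rightarrow>
     (real ^ 'n \<Rightarrow> real) \<Rightarrow> real \<Rightarrow> ('n \<Rightarrow> real) \<Rightarrow> ('n \<Rightarrow> real) \<Rightarrow>
     ('n \<Rightarrow> nat) \<Rightarrow> ('n \<Rightarrow> nat) \<Rightarrow> ('n \<Rightarrow> nat) \<Rightarrow>
     real \<Rightarrow> real \<Rightarrow> (real ^ 'n) \<times> (real ^ 'n) \<Rightarrow> (real ^ 'n) \<times> (real ^ 'n)" where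
  "es_field \<phi>1 \<phi>2 \<psi>11 \<psi>12 \<psi>21 \<psi>22 J \<epsilon> \<alpha> \<beta> \<kappa> \<mu>1 \<mu>2 \<omega> t = (\<lambda>(x, v).
     (\<chi> i. sqrt (2 * \<alpha> i * real (\<kappa> i) * \<omega>) *
             (\<phi>1 (J x / sqrt ((v $ i)\<^sup>2 + \<epsilon>)) * cos (real (\<kappa> i) * \<omega> * t) +
              \<phi>2 (J x / sqrt ((v $ i)\<^sup>2 + \<epsilon>)) * sin (real (\<kappa> i) * \<omega> * t)) +
           sqrt (2 * \<beta> i * \<omega>) *
             (sqrt (real (\<mu>1 i)) * \<psi>11 (J x) * cos (real (\<mu>1 i) * \<omega> * t) +
              sqrt (real (\<mu>2 i)) * \<psi>12 (J x) * cos (real (\<mu>2 i) * \<omega> * t)),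
      \<chi> i. - \<beta> i * v $ i +
           sqrt (2 * \<beta> i * \<omega>) *
             (sqrt (real (\<mu>1 i)) * \<psi>21 (J x) * sin (real (\<mu>1 i) * \<omega> * t) +
              sqrt (real (\<mu>2 i)) * \<psi>22 (J x) * sin (real (\<mu>2 i) * \<omega> * t))))"

end

theory Submission
  imports Defs
begin

text \<open>
  The averaged (Lie bracket) system is \<open>x\<^sub>i' = - \<alpha>\<^sub>i \<partial>\<^sub>iJ / sqrt (v\<^sub>i\<^sup>2 + \<epsilon>)\<close>, \<open>v\<^sub>i' = - \<beta>\<^sub>i (v\<^sub>i - \<partial>\<^sub>iJ)\<close>, and
  \<open>V = J + \<Sum>\<^sub>i c\<^sub>i v\<^sub>i\<^sup>2\<close> with small \<open>c\<^sub>i > 0\<close> is a strict Lyapunov function for it near the equilibrium.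
  Solutions of the original system are not compared with averaged ones. Instead \<open>V\<close> is expanded to
  second order along a solution over one common period \<open>h = 2\<pi> / \<omega>\<close> of the inputs: distinct
  frequencies do not resonate, so \<open>V\<close> changes by \<open>h\<close> times its derivative along the averaged system,
  up to \<open>o(h)\<close>, uniformly on a compact ball. For large \<open>\<omega>\<close> the values of \<open>V\<close> at the period ends thus
  decrease outside any prescribed neighbourhood of the equilibrium, while in between the state moves
  by \<open>O(1 / sqrt \<omega>)\<close> only. Solutions confined to the ball are global by Picard existence.
\<close>

section \<open>Local existence and continuation of solutions\<close>

text \<open>As \<open>J\<close> is only C^2, the derivative of \<open>V\<close> along an input field
  is only C^1, so an averaging error of order \<open>o(h)\<close> is all that can be expected. It
  suffices because on the part of the ball where \<open>V\<close> exceeds a given level the averaged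
  derivative of \<open>V\<close> is bounded away from zero by compactness. Below that level
  \<open>V\<close> may rise a little, which is why the stability is only practical. The averaged
  system arises from the interaction of the cosine field \<open>a\<close> and the sine field
  \<open>b\<close> of one frequency \<open>m\<close>: the derivative of \<open>V\<close> along their
  Lie bracket, divided by \<open>2 * m\<close>. Amplitudes proportional to \<open>sqrt m\<close>
  cancel this factor. The \<phi> pair moves \<open>x_i\<close> only, and the bracket -1 turns it
  into gradient descent. In the \<psi> pairs the cosine field moves \<open>x_i\<close> and the sine
  field \<open>v_i\<close>, and both depend on \<open>J x\<close> only; hence one half of the
  bracket vanishes, and the other pulls \<open>v_i\<close> towards the partial derivative of
  \<open>J\<close>, with coefficients that sum to 1 over the two pairs.\<close>

lemma solution_of_integral_equation:
  fixes F :: "real \<Rightarrow> 'a::euclidean_space \<Rightarrow> 'a"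
  assumes "continuous_on {a..b} (\<lambda>t. F t (q t))"
    and eq: "\<And>t. t \<in> {a..b} \<Longrightarrow> q t = x0 + integral {a..t} (\<lambda>\<tau>. F \<tau> (q \<tau>))"
    and t: "t \<in> {a..b}"
  shows "(q has_vector_derivative F t (q t)) (at t within {a..b})"
proof -
  have "((\<lambda>u. x0 + integral {a..u} (\<lambda>\<tau>. F \<tau> (q \<tau>))) has_vector_derivative (0 + F t (q t)))
      (at t within {a..b})"
    by (intro derivative_intros integral_has_vector_derivative assms t)
  then show ?thesis
    using has_vector_derivative_transform[OF t, of q] eq by auto
qed

text \<open>The right-hand side is bounded and Lipschitz on the ball uniformly in time, so the
  Picard operator is a contraction on the bounded continuous curves in the ball. These curves are
  defined on the whole real line; therefore the operator integrates up to a time clamped to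
  \<open>{T..T+d}\<close>.\<close>

lemma picard_local_existence:
  fixes F :: "real \<Rightarrow> 'a::euclidean_space \<Rightarrow> 'a"
  assumes cont: "continuous_on (UNIV \<times> cball x0 r) (\<lambda>(t, x). F t x)"
    and lip: "\<And>t x y. x \<in> cball x0 r \<Longrightarrow> y \<in> cball x0 r \<Longrightarrow> norm (F t x - F t y) \<le> L * norm (x - y)"
    and bound: "\<And>t x. x \<in> cball x0 r \<Longrightarrow> norm (F t x) \<le> M"
    and r: "r > 0"
  shows "\<exists>d>0. \<exists>q. q T = x0 \<and> (\<forall>t\<in>{T..T+d}. q t \<in> cball x0 r \<and>
           (q has_vector_derivative F t (q t)) (at t within {T..T+d}))"
proof -
  define M' where "M' = \<bar>M\<bar> + 1"
  define L' where "L' = \<bar>L\<bar> + 1"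
  \<comment> \<open>\<open>d * M' \<le> r\<close> keeps the image curves in the ball, and
    \<open>d * L' \<le> 1 / 2\<close> gives the contraction factor.\<close>
  define d where "d = min (r / M') (1 / (2 * L'))"
  have M': "M' > 0" "M \<le> M'" and L': "L' > 0" "L \<le> L'" by (auto simp: M'_def L'_def)
  have d: "d > 0" "d * M' \<le> r" "d * L' \<le> 1 / 2"
    using r M' L' by (auto simp: d_def min_def field_simps)
  define c where "c t = max T (min (T + d) t)" for t
  have c: "c t \<in> {T..T+d}" for t using d by (auto simp: c_def)
  have c_id: "c t = t" if "t \<in> {T..T+d}" for t using that by (auto simp: c_def)
  have cont_c: "continuous_on UNIV c" unfolding c_def by (intro continuous_intros)
  define S where "S = PiC (UNIV :: real set) (\<lambda>_. cball x0 r)"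
  have S_iff: "f \<in> S \<longleftrightarrow> (\<forall>t. apply_bcontfun f t \<in> cball x0 r)" for f
    by (auto simp: S_def mem_PiC_iff Pi_iff)
  define I where "I f t = integral {T..c t} (\<lambda>\<tau>. F \<tau> (apply_bcontfun f \<tau>))" for f t
  have cont_F: "continuous_on A (\<lambda>\<tau>. F \<tau> (apply_bcontfun f \<tau>))" if "f \<in> S" for f A
  proof -
    have "continuous_on A ((\<lambda>(t, x). F t x) \<circ> (\<lambda>\<tau>. (\<tau>, apply_bcontfun f \<tau>)))"
      by (rule continuous_on_compose, intro continuous_intros continuous_on_apply_bcontfun)
        (rule continuous_on_subset[OF cont], use that in \<open>auto simp: S_iff\<close>)
    then show ?thesis by (simp add: o_def)
  qed
  have integ: "(\<lambda>\<tau>. F \<tau> (apply_bcontfun f \<tau>)) integrable_on {a..b}" if "f \<in> S" for f a b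
    using cont_F[OF that] by (rule integrable_continuous_real)
  have I_bound: "norm (I f t) \<le> r" if "f \<in> S" for f t
  proof -
    have "norm (I f t) \<le> M' * (c t - T)"
      unfolding I_def
      by (rule integral_bound) (use c[of t] cont_F[OF that] bound M' that[unfolded S_iff] in
        \<open>auto intro: order_trans[OF bound]\<close>)
    also have "\<dots> \<le> M' * d" using c[of t] M' by (intro mult_left_mono) auto
    finally show ?thesis using d by (simp add: mult.commute)
  qed
  have cont_I: "continuous_on UNIV (I f)" if "f \<in> S" for f
  proof -
    have "continuous_on {T..T+d} (\<lambda>u. integral {T..u} (\<lambda>\<tau>. F \<tau> (apply_bcontfun f \<tau>)))"
      by (rule indefinite_integral_continuous_1[OF integ[OF that]])
    from continuous_on_compose2[OF this cont_c] show ?thesis using c by (auto simp: I_def[abs_def] image_subset_iff)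
  qed
  define P where "P f = Bcontfun (\<lambda>t. x0 + I f t)" for f
  have P: "apply_bcontfun (P f) t = x0 + I f t" if "f \<in> S" for f t
  proof -
    have "(\<lambda>t. x0 + I f t) \<in> bcontfun"
    proof (rule bcontfun_normI)
      show "continuous_on UNIV (\<lambda>t. x0 + I f t)" by (rule continuous_on_add[OF continuous_on_const cont_I[OF that]])
      show "norm (x0 + I f t) \<le> norm x0 + r" for t
        using I_bound[OF that, of t] norm_triangle_ineq[of x0 "I f t"] by linarith
    qed
    then show ?thesis by (simp add: P_def Bcontfun_inverse)
  qed
  have "\<exists>!f. f \<in> S \<and> P f = f"
  proof (rule Banach_fix[of S "1/2"])
    show "complete S"
      unfolding S_def by (intro closed_PiC[THEN complete_eq_closed[THEN iffD2]]) auto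
    show "S \<noteq> {}" using r S_iff[of "const_bcontfun x0"] by (auto simp: const_bcontfun.rep_eq)
    show "P ` S \<subseteq> S" using I_bound by (auto simp: S_iff P dist_norm)
    show "dist (P f) (P g) \<le> 1 / 2 * dist f g" if "f \<in> S" "g \<in> S" for f g
    proof (rule dist_bound)
      fix t
      have "I f t - I g t = integral {T..c t} (\<lambda>\<tau>. F \<tau> (apply_bcontfun f \<tau>) - F \<tau> (apply_bcontfun g \<tau>))"
        unfolding I_def by (rule integral_diff[symmetric]) (intro integ that)+
      also have "norm \<dots> \<le> (L' * dist f g) * (c t - T)"
      proof (rule integral_bound)
        show "T \<le> c t" using c[of t] by auto
        show "continuous_on {T..c t} (\<lambda>\<tau>. F \<tau> (apply_bcontfun f \<tau>) - F \<tau> (apply_bcontfun g \<tau>))"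
          by (intro continuous_intros cont_F that)
        fix \<tau>
        have "norm (F \<tau> (apply_bcontfun f \<tau>) - F \<tau> (apply_bcontfun g \<tau>))
            \<le> L * norm (apply_bcontfun f \<tau> - apply_bcontfun g \<tau>)"
          by (rule lip) (use that S_iff in auto)
        also have "\<dots> \<le> L' * dist f g"
          by (rule mult_mono) (use L' dist_bounded[of f \<tau> g] in \<open>auto simp: dist_norm\<close>)
        finally show "norm (F \<tau> (apply_bcontfun f \<tau>) - F \<tau> (apply_bcontfun g \<tau>)) \<le> L' * dist f g" .
      qed
      also have "\<dots> \<le> (L' * dist f g) * d" using c[of t] L' by (intro mult_left_mono) auto
      also have "\<dots> = (d * L') * dist f g" by simp
      also have "\<dots> \<le> 1 / 2 * dist f g" by (rule mult_right_mono) (use d in auto)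
      finally show "dist (apply_bcontfun (P f) t) (apply_bcontfun (P g) t) \<le> 1 / 2 * dist f g"
        by (simp add: P that dist_norm)
    qed
  qed auto
  then obtain f where f: "f \<in> S" "P f = f" by auto
  define q where "q = apply_bcontfun f"
  have q_eq: "q t = x0 + integral {T..t} (\<lambda>\<tau>. F \<tau> (q \<tau>))" if "t \<in> {T..T+d}" for t
    using P[OF f(1), of t] f(2) c_id[OF that] by (simp add: q_def I_def)
  have "q T = x0" using q_eq[of T] d by simp
  moreover have "q t \<in> cball x0 r" for t using f(1) by (auto simp: S_iff q_def)
  moreover have "(q has_vector_derivative F t (q t)) (at t within {T..T+d})" if "t \<in> {T..T+d}" for t
    by (rule solution_of_integral_equation[where q = q and F = F, OF _ q_eq that]) (use cont_F[OF f(1)] in \<open>auto simp: q_def\<close>)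
  ultimately show ?thesis using d(1) by blast
qed

text \<open>At the joint \<open>T\<close> the two one-sided derivatives agree, both being the value
  of \<open>F T\<close> at the common point \<open>q T = r T\<close>.\<close>

lemma solution_on_append:
  assumes q: "solution_on F U t0 {t0..T} q" and r: "solution_on F U T {T..T'} r"
    and eq: "r T = q T" and T: "T \<le> T'"
  shows "solution_on F U t0 {t0..T'} (\<lambda>t. if t \<le> T then q t else r t)" (is "solution_on _ _ _ _ ?p")
proof -
  have t0: "t0 \<le> T" using q by (auto simp: solution_on_def)
  have un: "{t0..T'} = {t0..T} \<union> {T..T'}" using t0 T by auto
  have p: "?p t = (if t \<in> {t0..T} then q t else r t)" if "t \<in> {t0..T'}" for t using that by auto
  have "(?p has_vector_derivative F t (?p t)) (at t within {t0..T'})" if t: "t \<in> {t0..T'}" for t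
  proof -
    have "((\<lambda>t. if t \<in> {t0..T} then q t else r t) has_vector_derivative
        (if t \<in> {t0..T} then F t (q t) else F t (r t))) (at t within {t0..T'})"
    proof (rule has_vector_derivative_If_within_closures[where T = "{T..T'}"])
      show "{t0..T'} = {t0..T} \<union> {T..T'}" "t \<in> {t0..T} \<union> {T..T'}" using un t by auto
      have *: "{t0..T} \<union> (closure {t0..T} \<inter> closure {T..T'}) = {t0..T}"
        "{T..T'} \<union> (closure {t0..T} \<inter> closure {T..T'}) = {T..T'}" using t0 T by auto
      show "(q has_vector_derivative F t (q t)) (at t within {t0..T} \<union> (closure {t0..T} \<inter> closure {T..T'}))"
        if "t \<in> {t0..T} \<union> (closure {t0..T} \<inter> closure {T..T'})"
        using that q unfolding * by (auto simp: solution_on_def)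
      show "(r has_vector_derivative F t (r t)) (at t within {T..T'} \<union> (closure {t0..T} \<inter> closure {T..T'}))"
        if "t \<in> {T..T'} \<union> (closure {t0..T} \<inter> closure {T..T'})"
        using that r unfolding * by (auto simp: solution_on_def)
    qed (use eq in auto)
    then show ?thesis
      using has_vector_derivative_transform[OF t p] p[OF t] by (auto split: if_splits)
  qed
  moreover have "?p ` {t0..T'} \<subseteq> U"
    using q r by (auto simp: solution_on_def image_subset_iff)
  ultimately show ?thesis using t0 T by (auto simp: solution_on_def)
qed

text \<open>Bounded speed makes \<open>q\<close> Lipschitz, so it has a limit at \<open>T\<close>,
  and the limit lies in the closed set \<open>K\<close>. The one-sided derivative at
  \<open>T\<close> is then read off the integral equation.\<close>

lemma solution_on_close:
  fixes F :: "real \<Rightarrow> 'a::euclidean_space \<Rightarrow> 'a"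
  assumes q: "solution_on F U t0 {t0..<T} q" and K: "compact K" "K \<subseteq> U" "q ` {t0..<T} \<subseteq> K"
    and cont: "continuous_on (UNIV \<times> U) (\<lambda>(t, x). F t x)"
    and bound: "\<And>t x. x \<in> K \<Longrightarrow> norm (F t x) \<le> M"
  shows "\<exists>p. solution_on F U t0 {t0..T} p \<and> (\<forall>t\<in>{t0..<T}. p t = q t)"
proof -
  have T: "t0 < T" using q by (auto simp: solution_on_def)
  have dq: "(q has_vector_derivative F t (q t)) (at t within {t0..<T})" if "t \<in> {t0..<T}" for t
    using q that by (auto simp: solution_on_def)
  have lip: "norm (q t - q s) \<le> M * norm (t - s)" if "t \<in> {t0..<T}" "s \<in> {t0..<T}" for t s
  proof (rule differentiable_bound[OF _ dq[unfolded has_vector_derivative_def]])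
    fix x assume "x \<in> {t0..<T}"
    then have "norm (F x (q x)) \<le> M" using K(3) bound by blast
    then show "onorm (\<lambda>h. h *\<^sub>R F x (q x)) \<le> M"
      using onorm_scaleR_left[of "\<lambda>h. h" "F x (q x)"] by (simp add: onorm_id bounded_linear_ident)
  qed (use that in auto)
  have "M \<ge> 0" using bound[of "q t0" t0] K(3) T norm_ge_zero[of "F t0 (q t0)"]
    by (smt (verit) atLeastLessThan_iff image_subset_iff)
  then have "uniformly_continuous_on {t0..<T} q"
    using lip by (intro lipschitz_on_uniformly_continuous[of M] lipschitz_onI) (auto simp: dist_norm)
  moreover have "T \<in> closure {t0..<T}" using T by simp
  ultimately obtain l where l: "(q \<longlongrightarrow> l) (at T within {t0..<T})"
    by (rule uniformly_continuous_on_extension_at_closure)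
  have nb: "at T within {t0..<T} \<noteq> bot"
    using \<open>T \<in> closure _\<close> by (simp add: at_within_eq_bot_iff trivial_limit_within islimpt_in_closure)
  have lK: "l \<in> K"
  proof (rule Lim_in_closed_set[OF compact_imp_closed[OF K(1)] _ nb l])
    show "\<forall>\<^sub>F x in at T within {t0..<T}. q x \<in> K"
      using K(3) by (auto simp: eventually_at_filter intro!: always_eventually)
  qed
  define p where "p t = (if t < T then q t else l)" for t
  have pK: "p t \<in> K" if "t \<in> {t0..T}" for t using that lK K(3) by (auto simp: p_def)
  have cont_p: "continuous_on {t0..T} p"
  proof -
    have cq: "continuous_on {t0..<T} q"
      using dq has_vector_derivative_continuous continuous_on_eq_continuous_within by blast
    have "continuous (at t within {t0..T}) p" if t: "t \<in> {t0..T}" for t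
    proof (cases "t = T")
      case True
      have "(p \<longlongrightarrow> l) (at T within {t0..<T})"
        by (rule Lim_transform_eventually[OF l]) (auto simp: eventually_at_filter p_def intro!: always_eventually)
      moreover have "at T within {t0..T} = at T within {t0..<T}"
        by (rule at_within_nhd[where S = UNIV]) auto
      ultimately show ?thesis using True by (simp add: continuous_within p_def)
    next
      case False
      then have tT: "t \<in> {t0..<T}" using t by auto
      have "at t within {t0..T} = at t within {t0..<T}"
        by (rule at_within_nhd[where S = "{..<T}"]) (use tT in auto)
      moreover have "continuous (at t within {t0..<T}) q"
        using cq tT by (auto simp: continuous_on_eq_continuous_within)
      then have "continuous (at t within {t0..<T}) p"
        by (rule continuous_transform_within[of _ _ _ 1]) (use tT in \<open>auto simp: p_def\<close>)
      ultimately show ?thesis by simp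
    qed
    then show ?thesis by (auto simp: continuous_on_eq_continuous_within)
  qed
  have cont_Fp: "continuous_on {t0..T} (\<lambda>t. F t (p t))"
  proof -
    have "continuous_on {t0..T} ((\<lambda>(t, x). F t x) \<circ> (\<lambda>t. (t, p t)))"
      by (rule continuous_on_compose, intro continuous_intros cont_p)
        (rule continuous_on_subset[OF cont], use pK K(2) in auto)
    then show ?thesis by (simp add: o_def)
  qed
  \<comment> \<open>At \<open>T\<close> only continuity of \<open>p\<close> is known so far, hence
    the form of the fundamental theorem that asks for derivatives in the interior only.\<close>
  have eq: "p t = p t0 + integral {t0..t} (\<lambda>\<tau>. F \<tau> (p \<tau>))" if t: "t \<in> {t0..T}" for t
  proof -
    have "((\<lambda>\<tau>. F \<tau> (p \<tau>)) has_integral (p t - p t0)) {t0..t}"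
    proof (rule fundamental_theorem_of_calculus_interior)
      show "continuous_on {t0..t} p" by (rule continuous_on_subset[OF cont_p]) (use t in auto)
      fix x assume x: "x \<in> {t0<..<t}"
      have "at x within {t0..<T} = at x"
        by (rule at_within_interior) (use x t in auto)
      then have "(q has_vector_derivative F x (q x)) (at x)" using dq[of x] x t by auto
      then have "(p has_vector_derivative F x (q x)) (at x)"
        by (rule has_vector_derivative_transform_within_open[where S = "{..<T}"])
          (use x t in \<open>auto simp: p_def\<close>)
      then show "(p has_vector_derivative F x (p x)) (at x)" using x t by (simp add: p_def)
    qed (use t in auto)
    then show ?thesis by (simp add: integral_unique)
  qed
  have "solution_on F U t0 {t0..T} p"
    unfolding solution_on_def
    using solution_of_integral_equation[where q = p and F = F, OF cont_Fp eq] T pK K(2)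
    by (auto simp: is_interval_cc)
  then show ?thesis by (intro exI[of _ p]) (auto simp: p_def)
qed

text \<open>If \<open>I\<close> were not the half-line, it would be bounded, and closed or half-open
  on the right. In the first case, which includes the degenerate interval \<open>{t0}\<close>,
  Picard existence continues the solution; in the second the limit adds the endpoint. Both
  contradict maximality.\<close>

lemma maximal_solution_in_compact:
  fixes F :: "real \<Rightarrow> 'a::euclidean_space \<Rightarrow> 'a"
  assumes q: "maximal_solution_on F U t0 I q"
    and K: "compact K" "K \<subseteq> U" "q ` I \<subseteq> K"
    and cont: "continuous_on (UNIV \<times> U) (\<lambda>(t, x). F t x)"
    and bound: "\<And>t x. x \<in> K \<Longrightarrow> norm (F t x) \<le> M"
    and local: "\<And>x. x \<in> K \<Longrightarrow> \<exists>r>0. cball x r \<subseteq> U \<and> (\<exists>L M. \<forall>t. (\<forall>y\<in>cball x r. norm (F t y) \<le> M) \<and>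
       (\<forall>y\<in>cball x r. \<forall>z\<in>cball x r. norm (F t y - F t z) \<le> L * norm (y - z)))"
  shows "I = {t0..}"
proof (rule ccontr)
  assume ne: "I \<noteq> {t0..}"
  have sol: "solution_on F U t0 I q" and
    max: "\<And>I' q'. I \<subset> I' \<Longrightarrow> solution_on F U t0 I' q' \<Longrightarrow> (\<And>t. t \<in> I \<Longrightarrow> q' t = q t) \<Longrightarrow> False"
    using q unfolding maximal_solution_on_def by blast+
  have I: "is_interval I" "t0 \<in> I" "I \<subseteq> {t0..}" using sol by (auto simp: solution_on_def)
  obtain T0 where T0: "T0 \<ge> t0" "T0 \<notin> I" using ne I by auto
  have below: "t < T0" if "t \<in> I" for t
    using I(1,2) T0 that unfolding is_interval_1 by (meson not_less)
  define T where "T = Sup I"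
  have bdd: "bdd_above I" using below by (meson bdd_above.I less_imp_le)
  have IT: "t \<le> T" if "t \<in> I" for t using cSup_upper[OF that bdd] by (simp add: T_def)
  have "{t0..<T} \<subseteq> I"
  proof
    fix t assume t: "t \<in> {t0..<T}"
    then obtain s where "s \<in> I" "t < s"
      using less_cSup_iff[of I t] bdd I(2) by (auto simp: T_def)
    then show "t \<in> I" using I(1,2) t unfolding is_interval_1
      by (meson atLeastLessThan_iff less_imp_le)
  qed
  then consider "I = {t0..T}" | "I = {t0..<T}"
  proof (cases "T \<in> I")
    case True
    then have "I = {t0..T}" using IT I \<open>{t0..<T} \<subseteq> I\<close>
      by (auto simp: set_eq_iff subset_iff) (metis less_le)
    then show ?thesis by (rule that)
  next
    case False
    then have "I = {t0..<T}" using IT I \<open>{t0..<T} \<subseteq> I\<close>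
      by (auto simp: set_eq_iff subset_iff) (metis less_le)
    then show ?thesis by (rule that)
  qed
  then show False
  proof cases
    case 1
    then have T: "t0 \<le> T" using I(2) by auto
    then have "q T \<in> K" using K(3) 1 by auto
    then obtain r L M' where r: "r > 0" "cball (q T) r \<subseteq> U"
      and LM: "\<And>t y. y \<in> cball (q T) r \<Longrightarrow> norm (F t y) \<le> M'"
      "\<And>t y z. y \<in> cball (q T) r \<Longrightarrow> z \<in> cball (q T) r \<Longrightarrow> norm (F t y - F t z) \<le> L * norm (y - z)"
      using local[of "q T"] by meson
    have "\<exists>d>0. \<exists>p. p T = q T \<and> (\<forall>t\<in>{T..T+d}. p t \<in> cball (q T) r \<and>
        (p has_vector_derivative F t (p t)) (at t within {T..T+d}))"
      by (rule picard_local_existence[OF continuous_on_subset[OF cont] LM(2) LM(1) r(1)])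
        (use r(2) in auto)
    then obtain d p where d: "d > 0" and p: "p T = q T"
      "\<And>t. t \<in> {T..T+d} \<Longrightarrow> p t \<in> cball (q T) r \<and> (p has_vector_derivative F t (p t)) (at t within {T..T+d})"
      by auto
    have "solution_on F U T {T..T+d} p"
      unfolding solution_on_def using p d r by (auto simp del: mem_cball)
    from solution_on_append[OF sol[unfolded 1] this p(1)] d
    have "solution_on F U t0 {t0..T+d} (\<lambda>t. if t \<le> T then q t else p t)" by simp
    then show False by (rule max[rotated]) (use 1 d T in auto)
  next
    case 2
    from solution_on_close[OF sol[unfolded 2] K(1,2) K(3)[unfolded 2] cont bound]
    obtain p where "solution_on F U t0 {t0..T} p" "\<forall>t\<in>{t0..<T}. p t = q t" by auto
moreover have "T \<in> {t0..T}" "T \<notin> {t0..<T}" "{t0..<T} \<subseteq> {t0..T}" using 2 I(2) by auto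
    then have "{t0..<T} \<subset> {t0..T}" by blast
    ultimately show False using max[of "{t0..T}" p] 2 by auto
  qed
qed

section \<open>Practical stability from decrease over one period\<close>

lemma compact_superlevel:
  fixes f :: "'a::euclidean_space \<Rightarrow> real"
  assumes "compact S" "continuous_on S f"
  shows "compact {x \<in> S. c \<le> f x}"
proof -
  have "closed (S \<inter> f -` {c..})"
    using assms by (intro continuous_closed_preimage compact_imp_closed closed_atLeast) auto
  then have "compact (S \<inter> (S \<inter> f -` {c..}))" by (rule compact_Int_closed[OF assms(1)])
  moreover have "S \<inter> (S \<inter> f -` {c..}) = {x \<in> S. c \<le> f x}" by auto
  ultimately show ?thesis by simp
qed

text \<open>Up to the first time at which the distance from \<open>qs\<close> is at least
  \<open>e\<close>, the speed is at most \<open>B\<close>. Within time \<open>h\<close> the solution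
  travels less than \<open>e / 2\<close>, so a start within \<open>e / 2\<close> cannot lead to
  distance \<open>e\<close>.\<close>

lemma solution_confined:
  fixes q :: "real \<Rightarrow> 'a::euclidean_space"
  assumes q: "solution_on F U t0 I q"
    and speed: "\<And>t x. x \<in> cball qs e \<Longrightarrow> norm (F t x) \<le> B"
    and B: "B * h < e / 2" "B \<ge> 0"
    and s: "s \<in> I" "norm (q s - qs) < e / 2"
    and t: "t \<in> I" "s \<le> t" "t \<le> s + h"
  shows "norm (q t - qs) < e"
proof (rule ccontr)
  assume out: "\<not> norm (q t - qs) < e"
  have I: "is_interval I" and
    dq: "\<And>t. t \<in> I \<Longrightarrow> (q has_vector_derivative F t (q t)) (at t within I)"
    using q by (auto simp: solution_on_def)
  have sub: "{s..t} \<subseteq> I" using I s t unfolding is_interval_1 by (meson atLeastAtMost_iff subsetI)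
  have cont: "continuous_on {s..t} q"
    using dq sub by (meson continuous_on_eq_continuous_within continuous_on_subset has_vector_derivative_continuous)
  define Z where "Z = {\<tau> \<in> {s..t}. e \<le> norm (q \<tau> - qs)}"
  have "compact Z" unfolding Z_def
    by (rule compact_superlevel[OF compact_Icc
          continuous_on_norm[OF continuous_on_diff[OF cont continuous_on_const]]])
  moreover have "t \<in> Z" using out t by (auto simp: Z_def)
  ultimately obtain \<tau> where \<tau>: "\<tau> \<in> Z" "\<And>x. x \<in> Z \<Longrightarrow> \<tau> \<le> x"
    using compact_attains_inf[of Z] by auto
  have e: "e > 0" using s(2) norm_ge_zero[of "q s - qs"] by linarith
  have "s \<noteq> \<tau>" using \<tau>(1) s(2) e by (auto simp: Z_def)
  then have "s < \<tau>" "\<tau> \<le> t" using \<tau>(1) by (auto simp: Z_def)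
  have "\<exists>x\<in>{s<..<\<tau>}. norm (q \<tau> - q s) \<le> norm ((\<tau> - s) *\<^sub>R F x (q x))"
  proof (rule mvt_general[OF \<open>s < \<tau>\<close>])
    show "continuous_on {s..\<tau>} q" by (rule continuous_on_subset[OF cont]) (use \<open>\<tau> \<le> t\<close> in auto)
    fix x assume x: "s < x" "x < \<tau>"
    then have "x \<in> interior I" using sub \<open>\<tau> \<le> t\<close>
      by (intro interiorI[of "{s<..<\<tau>}"]) auto
    then have "at x within I = at x" by (rule at_within_interior)
    then show "(q has_derivative (\<lambda>h. h *\<^sub>R F x (q x))) (at x)"
      using dq[of x] subsetD[OF sub, of x] x \<open>\<tau> \<le> t\<close> by (simp add: has_vector_derivative_def)
  qed
  then obtain x where x: "x \<in> {s<..<\<tau>}" "norm (q \<tau> - q s) \<le> norm ((\<tau> - s) *\<^sub>R F x (q x))" by blast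
  have "norm (q x - qs) < e" using \<tau>(2)[of x] x(1) \<open>\<tau> \<le> t\<close> by (force simp: Z_def)
  then have "norm (F x (q x)) \<le> B" by (intro speed) (simp add: dist_norm norm_minus_commute)
  then have "norm ((\<tau> - s) *\<^sub>R F x (q x)) \<le> h * B"
    unfolding norm_scaleR using \<open>s < \<tau>\<close> \<open>\<tau> \<le> t\<close> t B by (intro mult_mono) auto
  then have "norm (q \<tau> - q s) < e / 2" using x B by (simp add: mult.commute)
  moreover have "norm (q \<tau> - qs) \<le> norm (q \<tau> - q s) + norm (q s - qs)"
    using norm_triangle_ineq[of "q \<tau> - q s" "q s - qs"] by simp
  ultimately show False using s \<tau>(1) by (auto simp: Z_def)
qed

text \<open>
  Writing \<open>h = T / \<omega>\<close>, the sequence \<open>V (q (t0 + n * h))\<close> decreases by a multiple of \<open>h\<close> as long as it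
  is above a given level, and between these times the solution moves by at most \<open>C * T / sqrt \<omega>\<close>.
\<close>

lemma practical_asymptotic_stability_of_period_decrease:
  fixes F :: "real \<Rightarrow> real \<Rightarrow> 'a::euclidean_space \<Rightarrow> 'a" and V A :: "'a \<Rightarrow> real"
  assumes r: "r > 0"
    and contV: "continuous_on (cball qs r) V" and contA: "continuous_on (cball qs r) A"
    and pos: "\<And>x. x \<in> cball qs r \<Longrightarrow> x \<noteq> qs \<Longrightarrow> V qs < V x"
    and neg: "\<And>x. x \<in> cball qs r \<Longrightarrow> x \<noteq> qs \<Longrightarrow> A x < 0"
    and T: "T > 0"
    and speed: "\<And>\<omega> t x. \<omega> \<ge> 1 \<Longrightarrow> x \<in> cball qs r \<Longrightarrow> norm (F \<omega> t x) \<le> C * sqrt \<omega>"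
    and step: "\<And>\<eta>. \<eta> > 0 \<Longrightarrow> \<exists>\<omega>0. \<forall>\<omega>>\<omega>0. \<forall>s q.
       (\<forall>t\<in>{s..s+T/\<omega>}. q t \<in> cball qs r \<and>
          (q has_vector_derivative F \<omega> t (q t)) (at t within {s..s+T/\<omega>})) \<longrightarrow>
       V (q (s + T/\<omega>)) \<le> V (q s) + T/\<omega> * (A (q s) + \<eta>)"
    and global: "\<And>\<omega> t0 I q. \<omega> > 0 \<Longrightarrow> maximal_solution_on (F \<omega>) U t0 I q \<Longrightarrow>
       q ` I \<subseteq> cball qs r \<Longrightarrow> I = {t0..}"
  shows "practically_uniformly_asymptotically_stable F U qs"
proof -
  define K where "K = cball qs r"
  have K: "compact K" "qs \<in> K" using r by (auto simp: K_def)
  obtain MA where MA: "\<And>x. x \<in> K \<Longrightarrow> \<bar>A x\<bar> \<le> MA"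
    using compact_imp_bounded[OF compact_continuous_image[OF contA[folded K_def] K(1)]]
    by (auto simp: bounded_iff)
  have C: "C \<ge> 0" using speed[of 1 qs 0] r by (simp add: order_trans[OF norm_ge_zero])
  define sol where "sol \<omega> s q \<longleftrightarrow> (\<forall>t\<in>{s..s+T/\<omega>}. q t \<in> K \<and>
          (q has_vector_derivative F \<omega> t (q t)) (at t within {s..s+T/\<omega>}))" for \<omega> s q
  \<comment> \<open>\<open>c\<close> will bound from below the rise of \<open>V\<close> outside the
    ball of radius \<open>e / 2\<close>, and \<open>a\<close> will be a rate of decrease. The second
    conjunct bounds the distance travelled in one period; the last says that a period lowers
    \<open>V\<close> at rate \<open>a\<close> unless it ends at or below the level
    \<open>V qs + c / 2\<close>.\<close>
  define good where "good e c a \<omega> \<longleftrightarrow> \<omega> \<ge> 1 \<and> C * sqrt \<omega> * (T / \<omega>) < e / 2 \<and> T / \<omega> \<le> 1 \<and>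
    (\<forall>s q. sol \<omega> s q \<longrightarrow> V (q (s + T/\<omega>)) \<le> max (V (q s) - T/\<omega> * a) (V qs + c / 2))" for e c a \<omega>
  have ex_good: "\<exists>c>0. \<exists>a>0. \<exists>\<omega>0>0. (\<forall>x\<in>K. e / 2 \<le> norm (x - qs) \<longrightarrow> V qs + c \<le> V x) \<and>
      (\<forall>\<omega>>\<omega>0. good e c a \<omega>)" if e: "0 < e" "e \<le> r" for e
  proof -
    define K1 where "K1 = {x \<in> K. e / 2 \<le> norm (x - qs)}"
    have "compact K1" unfolding K1_def
      by (rule compact_superlevel[OF K(1)]) (intro continuous_intros)
    have "\<exists>c>0. \<forall>x\<in>K1. V qs + c \<le> V x"
    proof (cases "K1 = {}")
      case False
      obtain x0 where x0: "x0 \<in> K1" "\<And>x. x \<in> K1 \<Longrightarrow> V x0 \<le> V x"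
        using continuous_attains_inf[OF \<open>compact K1\<close> False continuous_on_subset[OF contV[folded K_def]]]
        by (auto simp: K1_def)
      have "x0 \<noteq> qs" using x0(1) e by (auto simp: K1_def)
      then have "V qs < V x0" using pos[folded K_def] x0(1) by (auto simp: K1_def)
      then show ?thesis using x0 by (intro exI[of _ "V x0 - V qs"]) auto
    qed (auto intro: exI[of _ 1])
    then obtain c where c: "c > 0" "\<And>x. x \<in> K1 \<Longrightarrow> V qs + c \<le> V x" by auto
    \<comment> \<open>Three levels above \<open>V qs\<close> interact: from \<open>c / 4\<close> on
      the decrease is uniform; from below \<open>c / 4\<close> one short period adds less than
      another \<open>c / 4\<close>, so it ends below \<open>c / 2\<close>; and in \<open>K\<close>,
      staying below \<open>c\<close> forces the state into the ball of radius
      \<open>e / 2\<close>.\<close>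
    define K2 where "K2 = {x \<in> K. V qs + c / 4 \<le> V x}"
    have "compact K2" unfolding K2_def
      by (rule compact_superlevel[OF K(1) contV[folded K_def]])
    have "\<exists>a>0. \<forall>x\<in>K2. A x \<le> - a"
    proof (cases "K2 = {}")
      case False
      obtain x0 where x0: "x0 \<in> K2" "\<And>x. x \<in> K2 \<Longrightarrow> A x \<le> A x0"
        using continuous_attains_sup[OF \<open>compact K2\<close> False continuous_on_subset[OF contA[folded K_def]]]
        by (auto simp: K2_def)
      have "x0 \<noteq> qs" using x0(1) c(1) by (auto simp: K2_def)
      then have "A x0 < 0" using neg[folded K_def] x0(1) by (auto simp: K2_def)
      then show ?thesis using x0 by (intro exI[of _ "- A x0"]) auto
    qed (auto intro: exI[of _ 1])
    then obtain a where a: "a > 0" "\<And>x. x \<in> K2 \<Longrightarrow> A x \<le> - a" by auto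
    \<comment> \<open>Half of the uniform rate \<open>a\<close> is given up to absorb the averaging
      error.\<close>
    obtain \<omega>1 where \<omega>1: "\<And>\<omega> s q. \<omega> > \<omega>1 \<Longrightarrow> sol \<omega> s q \<Longrightarrow>
        V (q (s + T/\<omega>)) \<le> V (q s) + T/\<omega> * (A (q s) + a / 2)"
      using step[of "a / 2"] a(1) unfolding sol_def K_def by force
    have "\<forall>\<^sub>F \<omega> in at_top. C * T / sqrt \<omega> < e / 2"
    proof (rule order_tendstoD(2))
      show "((\<lambda>\<omega>. C * T / sqrt \<omega>) \<longlongrightarrow> 0) at_top"
        by (intro tendsto_divide_0[OF tendsto_const] filterlim_at_top_imp_at_infinity sqrt_at_top)
    qed (use e in auto)
    moreover have lim0: "((\<lambda>\<omega>. T / \<omega>) \<longlongrightarrow> 0) at_top"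
      by (intro tendsto_divide_0[OF tendsto_const] filterlim_at_top_imp_at_infinity filterlim_ident)
    have "\<forall>\<^sub>F \<omega> in at_top. T / \<omega> < 1" by (rule order_tendstoD(2)[OF lim0]) auto
    moreover have "\<forall>\<^sub>F \<omega> in at_top. T / \<omega> * (MA + a / 2) < c / 4"
    proof (rule order_tendstoD(2))
      show "((\<lambda>\<omega>. T / \<omega> * (MA + a / 2)) \<longlongrightarrow> 0) at_top"
        using tendsto_mult_right[OF lim0, of "MA + a / 2"] by simp
    qed (use c in auto)
    moreover have "\<forall>\<^sub>F \<omega> in at_top. \<omega> > \<omega>1" "\<forall>\<^sub>F \<omega> in at_top. \<omega> \<ge> (1::real)"
      by (rule eventually_gt_at_top eventually_ge_at_top)+
    ultimately have "\<forall>\<^sub>F \<omega> in at_top. good e c (a / 2) \<omega>"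
    proof eventually_elim
      case (elim \<omega>)
      have h: "T / \<omega> > 0" using T elim by simp
      have "C * sqrt \<omega> * (T / \<omega>) = C * T / sqrt \<omega>"
        using elim by (simp add: field_simps flip: real_sqrt_mult)
      then have "C * sqrt \<omega> * (T / \<omega>) < e / 2" using elim(1) by simp
      moreover have "V (q (s + T/\<omega>)) \<le> max (V (q s) - T/\<omega> * (a / 2)) (V qs + c / 2)"
        if "sol \<omega> s q" for s q
      proof -
        have qs: "q s \<in> K" using that h by (auto simp: sol_def)
        note le = \<omega>1[OF elim(4) that]
        show ?thesis
        proof (cases "q s \<in> K2")
          case True
          then have "T/\<omega> * (A (q s) + a / 2) \<le> T/\<omega> * (- (a / 2))"
            using h a(2)[OF True] by (intro mult_left_mono) auto
          then show ?thesis using le by simp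
        next
          case False
          then have "V (q s) < V qs + c / 4" using qs by (auto simp: K2_def)
          moreover have "T/\<omega> * (A (q s) + a / 2) \<le> T/\<omega> * (MA + a / 2)"
            using h MA[OF qs] by (intro mult_left_mono) auto
          ultimately have "V (q (s + T/\<omega>)) \<le> V qs + c / 2" using le elim(3) by linarith
          then show ?thesis by simp
        qed
      qed
      ultimately show ?case using elim by (auto simp: good_def)
    qed
    then obtain \<omega>2 where "\<And>\<omega>. \<omega> \<ge> \<omega>2 \<Longrightarrow> good e c (a / 2) \<omega>"
      by (auto simp: eventually_at_top_linorder)
    then have "\<forall>\<omega>>max 1 \<omega>2. good e c (a / 2) \<omega>" by auto
    moreover have "max 1 \<omega>2 > (0::real)" by simp
    moreover have "a / 2 > 0" using a by simp
    ultimately show ?thesis using c unfolding K1_def by blast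
  qed
  have confined: "norm (q t - qs) < e"
    if "0 < e" "e \<le> r" "good e c a \<omega>" "solution_on (F \<omega>) U t0 I q" "s \<in> I" "norm (q s - qs) < e / 2"
      "t \<in> I" "s \<le> t" "t \<le> s + T / \<omega>" for e c a \<omega> t0 I q s t
  proof (rule solution_confined[OF that(4)])
    show "norm (F \<omega> t x) \<le> C * sqrt \<omega>" if "x \<in> cball qs e" for t x
      using that \<open>e \<le> r\<close> \<open>good e c a \<omega>\<close> by (intro speed) (auto simp: good_def)
    show "C * sqrt \<omega> * (T / \<omega>) < e / 2" "0 \<le> C * sqrt \<omega>" using that C by (auto simp: good_def)
  qed (use that in auto)
  have sol_sub: "sol \<omega> s q"
    if "solution_on (F \<omega>) U t0 I q" "s \<in> I" "s + T / \<omega> \<in> I"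
      and small: "\<And>t. t \<in> I \<Longrightarrow> t \<le> s + T / \<omega> \<Longrightarrow> norm (q t - qs) < r"
    for \<omega> t0 I q s
  proof -
    have sub: "{s..s+T/\<omega>} \<subseteq> I"
      using that(1-3) unfolding solution_on_def is_interval_1 by (meson atLeastAtMost_iff subsetI)
    have "(q has_vector_derivative F \<omega> t (q t)) (at t within {s..s+T/\<omega>})" if "t \<in> {s..s+T/\<omega>}" for t
      using \<open>solution_on (F \<omega>) U t0 I q\<close> subsetD[OF sub that]
      by (intro has_vector_derivative_within_subset[OF _ sub]) (auto simp: solution_on_def)
    moreover have "q t \<in> K" if t: "t \<in> {s..s+T/\<omega>}" for t
      using sub t small[of t] by (auto simp: K_def dist_norm norm_minus_commute intro: less_imp_le)
    ultimately show ?thesis by (auto simp: sol_def)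
  qed
  \<comment> \<open>Within \<open>K\<close> the set \<open>V x \<le> V qs + c / 2\<close> lies in
    the ball of radius \<open>e / 2\<close>, and the solution cannot leave it at the period ends. In
    between, \<open>confined\<close> keeps the solution within \<open>e\<close>.\<close>
  have trapped: "(\<forall>t\<in>I. norm (q t - qs) < e)"
    if e: "0 < e" "e \<le> r" and c: "c > 0" "\<forall>x\<in>K. e / 2 \<le> norm (x - qs) \<longrightarrow> V qs + c \<le> V x"
      and a: "a > 0" and g: "good e c a \<omega>" and q: "solution_on (F \<omega>) U t0 I q"
      and init: "norm (q t0 - qs) < e / 2" "V (q t0) \<le> V qs + c / 2"
    for e c a \<omega> t0 I q
  proof -
    define s where "s n = t0 + real n * (T / \<omega>)" for n
    have \<omega>: "\<omega> \<ge> 1" using g by (auto simp: good_def)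
    have h: "T / \<omega> > 0" using T \<omega> by simp
    have s_Suc: "s (Suc n) = s n + T / \<omega>" for n by (simp add: s_def algebra_simps)
    have I: "is_interval I" "t0 \<in> I" "\<And>t. t \<in> I \<Longrightarrow> t0 \<le> t" using q by (auto simp: solution_on_def)
    have s_ge: "t0 \<le> s n" for n using h by (simp add: s_def del: times_divide_eq_right)
    have in_I: "x \<in> I" if "t0 \<le> x" "x \<le> y" "y \<in> I" for x y
      using I(1,2) that unfolding is_interval_1 by blast
    \<comment> \<open>A priori \<open>I\<close> may be bounded, so the claims at \<open>s n\<close>
      are conditional. The bound for all times up to \<open>s n\<close> is part of the induction
      because the estimate over a period presupposes that the whole window lies in
      \<open>K\<close>.\<close>
    have inv: "(s n \<in> I \<longrightarrow> V (q (s n)) \<le> V qs + c / 2 \<and> norm (q (s n) - qs) < e / 2) \<and>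
       (\<forall>t\<in>I. t \<le> s n \<longrightarrow> norm (q t - qs) < e)" for n
    proof (induction n)
      case 0
      have "norm (q t0 - qs) < e" using init(1) e by linarith
      then show ?case using init I(3) by (auto simp: s_def dest: antisym)
    next
      case (Suc n)
      have before: "norm (q t - qs) < e" if t: "t \<in> I" "t \<le> s (Suc n)" for t
      proof (cases "t \<le> s n")
        case False
        have "s n \<in> I" by (rule in_I[OF s_ge _ t(1)]) (use False in simp)
        then show ?thesis
          using confined[OF e g q, of "s n" t] Suc t False by (simp add: s_Suc)
      qed (use Suc t in auto)
      have "V (q (s (Suc n))) \<le> V qs + c / 2 \<and> norm (q (s (Suc n)) - qs) < e / 2" if sI: "s (Suc n) \<in> I"
      proof
        have sn: "s n \<in> I" by (rule in_I[OF s_ge _ sI]) (use h in \<open>simp add: s_Suc del: zero_less_divide_iff\<close>)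
        have "sol \<omega> (s n) q"
          by (rule sol_sub[OF q sn]) (use sI before e in \<open>force simp: s_Suc\<close>)+
        then have "V (q (s (Suc n))) \<le> max (V (q (s n)) - T/\<omega> * a) (V qs + c / 2)"
          using g by (auto simp: good_def s_Suc)
        moreover have "T/\<omega> * a > 0" using h a by (rule mult_pos_pos)
        moreover have "V (q (s n)) \<le> V qs + c / 2" using Suc sn by blast
        ultimately show le: "V (q (s (Suc n))) \<le> V qs + c / 2" by linarith
        have "norm (q (s (Suc n)) - qs) < e" using before sI by blast
        then have "q (s (Suc n)) \<in> K" using e by (simp add: K_def dist_norm norm_minus_commute)
        moreover have "\<not> V qs + c \<le> V (q (s (Suc n)))" using le c(1) by linarith
        ultimately show "norm (q (s (Suc n)) - qs) < e / 2" using c(2) not_less by blast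
      qed
      then show ?case using before by blast
    qed
    show ?thesis
    proof
      fix t assume t: "t \<in> I"
      obtain n where "(t - t0) / (T / \<omega>) \<le> real n" using real_arch_simple by blast
      then have "t \<le> s n" using h by (simp add: s_def pos_divide_le_eq del: times_divide_eq_right divide_divide_eq_right)
      then show "norm (q t - qs) < e" using inv t by blast
    qed
  qed
  have near: "\<exists>\<delta>>0. \<delta> \<le> e / 2 \<and> (\<forall>x. norm (x - qs) < \<delta> \<longrightarrow> V x \<le> V qs + c / 2)"
    if "0 < e" "e \<le> r" "c > 0" for e c
  proof -
    have "isCont V qs"
      using continuous_on_subset[OF contV ball_subset_cball] r
      by (simp add: continuous_on_eq_continuous_at)
    then obtain d where d: "d > 0" "\<And>x. dist x qs < d \<Longrightarrow> dist (V x) (V qs) < c / 2"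
      unfolding continuous_at_eps_delta using \<open>c > 0\<close> by (metis half_gt_zero)
    have "V x \<le> V qs + c / 2" if "norm (x - qs) < min d (e / 2)" for x
      using d(2)[of x] that by (simp add: dist_norm dist_real_def) (smt (verit) field_sum_of_halves)
    then show ?thesis using d that by (intro exI[of _ "min d (e / 2)"]) auto
  qed
  have in_cball: "q ` I \<subseteq> cball qs r" if "\<forall>t\<in>I. norm (q t - qs) < e" "e \<le> r" for q I e
    using that by (force simp: dist_norm norm_minus_commute)
  show ?thesis
    unfolding practically_uniformly_asymptotically_stable_def
  proof
    show "practically_uniformly_stable F U qs"
      unfolding practically_uniformly_stable_def
    proof (intro allI impI)
      fix \<epsilon> :: real assume "\<epsilon> > 0"
      define e where "e = min \<epsilon> r"
      have e: "0 < e" "e \<le> r" "e \<le> \<epsilon>" using r \<open>\<epsilon> > 0\<close> by (auto simp: e_def)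
      obtain c a \<omega>0 where g: "c > 0" "a > 0" "\<omega>0 > 0"
        "\<forall>x\<in>K. e / 2 \<le> norm (x - qs) \<longrightarrow> V qs + c \<le> V x" "\<And>\<omega>. \<omega> > \<omega>0 \<Longrightarrow> good e c a \<omega>"
        using ex_good[OF e(1,2)] by metis
      obtain \<delta> where \<delta>: "\<delta> > 0" "\<delta> \<le> e / 2" "\<And>x. norm (x - qs) < \<delta> \<Longrightarrow> V x \<le> V qs + c / 2"
        using near[OF e(1,2) g(1)] by blast
      have "I = {t0..} \<and> (\<forall>t\<ge>t0. norm (q t - qs) < \<epsilon>)"
        if "\<omega> > \<omega>0" "maximal_solution_on (F \<omega>) U t0 I q" "norm (q t0 - qs) < \<delta>" for \<omega> t0 I q
      proof -
        have tr: "\<forall>t\<in>I. norm (q t - qs) < e"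
          by (rule trapped[OF e(1,2) g(1,4,2) g(5)[OF that(1)]])
            (use that \<delta> in \<open>auto simp: maximal_solution_on_def\<close>)
        then have "I = {t0..}"
          using global[OF _ that(2) in_cball[OF tr e(2)]] that(1) g(3) by simp
        then show ?thesis using tr e(3) by force
      qed
      then show "\<exists>\<delta>>0. \<exists>\<omega>0>0. \<forall>\<omega>>\<omega>0. \<forall>t0\<ge>0. \<forall>I q.
          maximal_solution_on (F \<omega>) U t0 I q \<and> norm (q t0 - qs) < \<delta> \<longrightarrow>
            I = {t0..} \<and> (\<forall>t\<ge>t0. norm (q t - qs) < \<epsilon>)"
        using \<delta>(1) g(3) by blast
    qed
    \<comment> \<open>Attractivity needs \<open>\<delta>\<close> before \<open>\<epsilon>\<close> is
      given, so \<open>c\<close> and \<open>\<delta>\<close> are taken for the fixed radius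
      \<open>r\<close>; the primed constants below depend on \<open>\<epsilon>\<close>.\<close>
    obtain c a \<omega>0 where g: "c > 0" "a > 0" "\<omega>0 > 0"
      "\<forall>x\<in>K. r / 2 \<le> norm (x - qs) \<longrightarrow> V qs + c \<le> V x" "\<And>\<omega>. \<omega> > \<omega>0 \<Longrightarrow> good r c a \<omega>"
      using ex_good[OF r order_refl] by metis
    obtain \<delta> where \<delta>: "\<delta> > 0" "\<delta> \<le> r / 2" "\<And>x. norm (x - qs) < \<delta> \<Longrightarrow> V x \<le> V qs + c / 2"
      using near[OF r order_refl g(1)] by blast
    show "practically_uniformly_attractive F U qs"
      unfolding practically_uniformly_attractive_def
    proof (rule exI[of _ \<delta>], intro conjI allI impI \<delta>(1))
      fix \<epsilon> :: real assume "\<epsilon> > 0"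
      define e where "e = min \<epsilon> r"
      have e: "0 < e" "e \<le> r" "e \<le> \<epsilon>" using r \<open>\<epsilon> > 0\<close> by (auto simp: e_def)
      obtain c' a' \<omega>1 where g': "c' > 0" "a' > 0" "\<omega>1 > 0"
        "\<forall>x\<in>K. e / 2 \<le> norm (x - qs) \<longrightarrow> V qs + c' \<le> V x" "\<And>\<omega>. \<omega> > \<omega>1 \<Longrightarrow> good e c' a' \<omega>"
        using ex_good[OF e(1,2)] by metis
      \<comment> \<open>\<open>V\<close> starts at most \<open>c / 2\<close> above
        \<open>V qs\<close> and decreases at rate \<open>a'\<close> until it is at most
        \<open>c' / 2\<close> above, so time \<open>c / (2 * a')\<close> is enough. The additional 1
        pays for rounding down to a whole number of periods, each of length at most 1.\<close>
      define tf where "tf = c / (2 * a') + 1"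
      have "I = {t0..} \<and> (\<forall>t\<ge>t0 + tf. norm (q t - qs) < \<epsilon>)"
        if \<omega>: "\<omega> > max \<omega>0 \<omega>1" and max: "maximal_solution_on (F \<omega>) U t0 I q"
          and init: "norm (q t0 - qs) < \<delta>" for \<omega> t0 I q
      proof -
        have q: "solution_on (F \<omega>) U t0 I q" using max by (simp add: maximal_solution_on_def)
        have tr: "\<forall>t\<in>I. norm (q t - qs) < r"
          by (rule trapped[OF r order_refl g(1,4,2) g(5) q]) (use \<omega> init \<delta> in auto)
        then have I: "I = {t0..}"
          using global[OF _ max in_cball[OF tr]] \<omega> g(3) by simp
        have \<omega>': "good e c' a' \<omega>" using \<omega> g'(5) by simp
        then have h: "T / \<omega> > 0" "T / \<omega> \<le> 1" using T by (auto simp: good_def)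
        define s where "s n = t0 + real n * (T / \<omega>)" for n
        have s_Suc: "s (Suc n) = s n + T / \<omega>" for n by (simp add: s_def algebra_simps)
        have s_I: "s n \<in> I" for n using h by (simp add: s_def I del: times_divide_eq_right)
        have dec: "V (q (s n)) \<le> max (V qs + c / 2 - real n * (T / \<omega>) * a') (V qs + c' / 2)" for n
        proof (induction n)
          case 0
          show ?case using \<delta>(3)[OF init] by (simp add: s_def)
        next
          case (Suc n)
          have "sol \<omega> (s n) q"
            by (rule sol_sub[OF q s_I]) (use s_I[of "Suc n"] tr in \<open>auto simp: s_Suc\<close>)
          then have "V (q (s (Suc n))) \<le> max (V (q (s n)) - T/\<omega> * a') (V qs + c' / 2)"
            using \<omega>' by (auto simp: good_def s_Suc)
          moreover have "T/\<omega> * a' > 0" using h g' by (intro mult_pos_pos)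
          moreover have "real (Suc n) * (T / \<omega>) * a' = real n * (T / \<omega>) * a' + T/\<omega> * a'"
            by (simp only: of_nat_Suc distrib_right mult_1)
          ultimately show ?case using Suc by linarith
        qed
        have "norm (q t - qs) < \<epsilon>" if t: "t \<ge> t0 + tf" for t
        proof -
          define n where "n = nat \<lfloor>(t - t0) / (T / \<omega>)\<rfloor>"
          have "t - t0 \<ge> 0" using t g(1) g'(2) by (simp add: tf_def) (smt (verit) divide_nonneg_nonneg)
          then have "(t - t0) / (T / \<omega>) \<ge> 0" using h by (intro divide_nonneg_pos)
          then have n: "real n \<le> (t - t0) / (T / \<omega>)" "(t - t0) / (T / \<omega>) < real n + 1"
            unfolding n_def by linarith+
          have n': "real n * (T / \<omega>) \<le> t - t0" using n(1) h(1) pos_le_divide_eq by blast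
          have n'': "t - t0 < real n * (T / \<omega>) + T / \<omega>"
            using n(2) h(1) pos_divide_less_eq[of "T / \<omega>" "t - t0" "real n + 1"]
            by (simp only: distrib_right mult_1)
          have "c / (2 * a') \<le> real n * (T / \<omega>)" using n'' h t unfolding tf_def by linarith
          then have "c / 2 \<le> real n * (T / \<omega>) * a'"
            using g'(2) by (simp add: field_simps)
          then have le: "V (q (s n)) \<le> V qs + c' / 2" using dec[of n] g'(1) by linarith
          have "q (s n) \<in> K" using tr s_I[of n] by (force simp: K_def dist_norm norm_minus_commute)
          then have "norm (q (s n) - qs) < e / 2" using g'(1,4) le by force
          then have "norm (q t - qs) < e"
            using confined[OF e(1,2) \<omega>' q s_I[of n], of t] n' n'' \<open>t - t0 \<ge> 0\<close>
            by (simp add: s_def I)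
          then show ?thesis using e by simp
        qed
        then show ?thesis using I by blast
      qed
      moreover have "tf \<ge> 0" using g g' by (simp add: tf_def)
      moreover have "max \<omega>0 \<omega>1 > 0" using g by simp
      ultimately show "\<exists>tf\<ge>0. \<exists>\<omega>0>0. \<forall>\<omega>>\<omega>0. \<forall>t0\<ge>0. \<forall>I q.
          maximal_solution_on (F \<omega>) U t0 I q \<and> norm (q t0 - qs) < \<delta> \<longrightarrow>
            I = {t0..} \<and> (\<forall>t\<ge>t0 + tf. norm (q t - qs) < \<epsilon>)"
        by blast
    qed
  qed
qed

section \<open>Averaging over one period\<close>

text \<open>
  The time scale is \<open>\<theta> = \<omega> * t\<close> and \<open>\<mu> = 1 / sqrt \<omega>\<close>. Over one period \<open>p \<theta>\<close> equals
  \<open>y + \<mu> *\<^sub>R (H \<theta> y - H \<theta>0 y)\<close> up to \<open>O(\<mu>\<^sup>2)\<close>, where \<open>y = p \<theta>0\<close>; inserting this into the first-order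
  Taylor expansion of \<open>V' x (G \<theta> x)\<close> at \<open>y\<close> yields the derivative of \<open>V\<close> along \<open>p\<close> up to \<open>o(\<mu>\<^sup>2)\<close>.
  No second derivative of this function is available, whence the remainder without a rate.
\<close>

lemma averaging_over_period:
  fixes f0 :: "'a::euclidean_space \<Rightarrow> 'a" and G H :: "real \<Rightarrow> 'a \<Rightarrow> 'a" and V :: "'a \<Rightarrow> real"
  assumes dV: "\<And>x. x \<in> K \<Longrightarrow> (V has_derivative V' x) (at x)"
    and M: "\<And>x. x \<in> K \<Longrightarrow> norm (f0 x) \<le> M" "\<And>\<theta> x. x \<in> K \<Longrightarrow> norm (G \<theta> x) \<le> M"
    and L: "\<And>\<theta> x y. x \<in> K \<Longrightarrow> y \<in> K \<Longrightarrow> norm (G \<theta> y - G \<theta> x) \<le> L * norm (y - x)"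
    and drift: "uniformly_continuous_on K (\<lambda>x. V' x (f0 x))"
    and g': "\<And>\<theta> x. x \<in> K \<Longrightarrow> linear (g' \<theta> x)" "\<And>\<theta> x v. x \<in> K \<Longrightarrow> \<bar>g' \<theta> x v\<bar> \<le> C * norm v"
    and remainder: "\<And>e. e > 0 \<Longrightarrow> \<exists>d>0. \<forall>\<theta>. \<forall>x\<in>K. \<forall>y\<in>K. norm (y - x) < d \<longrightarrow>
        \<bar>V' y (G \<theta> y) - V' x (G \<theta> x) - g' \<theta> x (y - x)\<bar> \<le> e * norm (y - x)"
    and H: "\<And>\<theta> x. x \<in> K \<Longrightarrow> ((\<lambda>\<theta>. H \<theta> x) has_vector_derivative G \<theta> x) (at \<theta>)"
    and mean0: "\<And>\<theta>0 x. x \<in> K \<Longrightarrow> ((\<lambda>\<theta>. V' x (G \<theta> x)) has_integral 0) {\<theta>0..\<theta>0 + 2 * pi}"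
    and mean1: "\<And>\<theta>0 x. x \<in> K \<Longrightarrow>
        ((\<lambda>\<theta>. g' \<theta> x (H \<theta> x - H \<theta>0 x)) has_integral 2 * pi * B x) {\<theta>0..\<theta>0 + 2 * pi}"
    and \<eta>: "\<eta> > 0"
  shows "\<exists>\<mu>0>0. \<forall>\<mu> \<theta>0 p. 0 < \<mu> \<and> \<mu> < \<mu>0 \<and> (\<forall>\<theta>\<in>{\<theta>0..\<theta>0 + 2 * pi}. p \<theta> \<in> K \<and>
      (p has_vector_derivative \<mu>\<^sup>2 *\<^sub>R f0 (p \<theta>) + \<mu> *\<^sub>R G \<theta> (p \<theta>)) (at \<theta> within {\<theta>0..\<theta>0 + 2 * pi})) \<longrightarrow>
      V (p (\<theta>0 + 2 * pi)) \<le> V (p \<theta>0) + 2 * pi * \<mu>\<^sup>2 * (V' (p \<theta>0) (f0 (p \<theta>0)) + B (p \<theta>0) + \<eta>)"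
proof -
  define M' where "M' = \<bar>M\<bar> + 1"
  define L' where "L' = \<bar>L\<bar>"
  define C' where "C' = \<bar>C\<bar>"
  \<comment> \<open>Over a period \<open>p\<close> moves by at most \<open>\<mu> * R\<close> (two
    fields bounded by \<open>M'\<close>, length \<open>2 * pi\<close>), and it deviates from the
    first-order motion by at most \<open>\<mu>\<^sup>2 * R2\<close>.\<close>
  define R where "R = 4 * pi * M'"
  define R2 where "R2 = 2 * pi * (M' + L' * R)"
  have M': "M' > 0" "M \<le> M'" and L': "L' \<ge> 0" "L \<le> L'" and C': "C' \<ge> 0" "C \<le> C'"
    by (auto simp: M'_def L'_def C'_def)
  have R: "R > 0" using M' by (simp add: R_def)
  have R2: "R2 > 0" unfolding R2_def using M' L' R pi_gt_zero
    by (intro mult_pos_pos add_pos_nonneg mult_nonneg_nonneg) auto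
  obtain d1 where d1: "d1 > 0" "\<And>x y. x \<in> K \<Longrightarrow> y \<in> K \<Longrightarrow> norm (y - x) < d1 \<Longrightarrow>
      \<bar>V' y (f0 y) - V' x (f0 x)\<bar> \<le> \<eta> / 3"
    using drift \<eta> unfolding uniformly_continuous_on_def dist_norm
    by (metis divide_pos_pos less_imp_le real_norm_def zero_less_numeral)
  have "\<eta> / (3 * R) > 0" using \<eta> R by simp
  then obtain d2 where d2: "d2 > 0" "\<And>\<theta> x y. x \<in> K \<Longrightarrow> y \<in> K \<Longrightarrow> norm (y - x) < d2 \<Longrightarrow>
      \<bar>V' y (G \<theta> y) - V' x (G \<theta> x) - g' \<theta> x (y - x)\<bar> \<le> \<eta> / (3 * R) * norm (y - x)"
    using remainder[of "\<eta> / (3 * R)"] by blast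
  \<comment> \<open>In order, the bounds ensure \<open>\<mu>\<^sup>2 \<le> \<mu>\<close>, a drift
    error of at most \<open>\<eta> / 3\<close>, validity of the Taylor estimate along the whole
    period, and a cost of at most \<open>\<mu> * (\<eta> / 3)\<close> for the deviation from the
    first-order motion. Each of the three errors finally contributes at most
    \<open>\<mu>\<^sup>2 * (\<eta> / 3)\<close>.\<close>
  define \<mu>0 where "\<mu>0 = min (min 1 (d1 / R)) (min (d2 / R) (\<eta> / 3 / ((C' + 1) * R2)))"
  have "\<mu>0 > 0" using d1 d2 R R2 C' \<eta> by (auto simp: \<mu>0_def intro!: divide_pos_pos mult_pos_pos)
  moreover have "V (p (\<theta>0 + 2 * pi)) \<le> V (p \<theta>0) +
      2 * pi * \<mu>\<^sup>2 * (V' (p \<theta>0) (f0 (p \<theta>0)) + B (p \<theta>0) + \<eta>)"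
    if \<mu>: "0 < \<mu>" "\<mu> < \<mu>0" and p: "\<And>\<theta>. \<theta> \<in> {\<theta>0..\<theta>0 + 2 * pi} \<Longrightarrow> p \<theta> \<in> K"
      and dp: "\<And>\<theta>. \<theta> \<in> {\<theta>0..\<theta>0 + 2 * pi} \<Longrightarrow>
        (p has_vector_derivative \<mu>\<^sup>2 *\<^sub>R f0 (p \<theta>) + \<mu> *\<^sub>R G \<theta> (p \<theta>)) (at \<theta> within {\<theta>0..\<theta>0 + 2 * pi})"
    for \<mu> \<theta>0 p
  proof -
    define S where "S = {\<theta>0..\<theta>0 + 2 * pi}"
    have S0: "\<theta>0 \<in> S" by (simp add: S_def)
    have S_len: "norm (\<theta> - \<theta>0) \<le> 2 * pi" if "\<theta> \<in> S" for \<theta> using that by (auto simp: S_def)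
    define y where "y = p \<theta>0"
    have y: "y \<in> K" using p by (simp add: y_def)
    have \<mu>': "\<mu> \<le> 1" "\<mu> * R < d1" "\<mu> * R < d2"
      using \<mu> R by (auto simp: \<mu>0_def field_simps)
    have "(C' + 1) * R2 > 0" using C' R2 by simp
    then have \<mu>'': "\<mu> * ((C' + 1) * R2) < \<eta> / 3"
      using \<mu>(2) pos_less_divide_eq[of "(C' + 1) * R2" \<mu> "\<eta> / 3"]
      unfolding \<mu>0_def min_less_iff_conj by blast
    have "\<mu>\<^sup>2 \<le> \<mu>" using \<mu> \<mu>'(1) by (simp add: power2_eq_square mult_left_le_one_le)
    have bound: "norm (u \<theta> - u \<theta>0) \<le> D * (2 * pi)"
      if "\<And>\<theta>. \<theta> \<in> S \<Longrightarrow> (u has_vector_derivative u' \<theta>) (at \<theta> within S)" "\<And>\<theta>. \<theta> \<in> S \<Longrightarrow> norm (u' \<theta>) \<le> D" "\<theta> \<in> S"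
      for u u' :: "real \<Rightarrow> 'a" and D \<theta>
    proof -
      have "norm (u \<theta> - u \<theta>0) \<le> D * norm (\<theta> - \<theta>0)"
      proof (rule differentiable_bound[of S u "\<lambda>\<theta> h. h *\<^sub>R u' \<theta>"])
        show "convex S" by (simp add: S_def)
        show "onorm (\<lambda>h. h *\<^sub>R u' x) \<le> D" if "x \<in> S" for x
          using onorm_scaleR_left[of "\<lambda>h. h" "u' x"] \<open>x \<in> S \<Longrightarrow> norm (u' x) \<le> D\<close> that
          by (simp add: onorm_id)
      qed (use that S0 in \<open>auto simp: has_vector_derivative_def\<close>)
      also have "\<dots> \<le> D * (2 * pi)"
        using S_len[OF that(3)] norm_ge_zero[of "u' \<theta>"] that(2)[OF that(3)]
        by (intro mult_left_mono) linarith+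
      finally show ?thesis .
    qed
    have near: "norm (p \<theta> - y) \<le> \<mu> * R" if \<theta>: "\<theta> \<in> S" for \<theta>
    proof -
      have "norm (p \<theta> - p \<theta>0) \<le> (\<mu> * (2 * M')) * (2 * pi)"
      proof (rule bound[OF _ _ \<theta>])
        fix \<theta> assume \<theta>: "\<theta> \<in> S"
        show "(p has_vector_derivative \<mu>\<^sup>2 *\<^sub>R f0 (p \<theta>) + \<mu> *\<^sub>R G \<theta> (p \<theta>)) (at \<theta> within S)"
          using dp \<theta> by (simp add: S_def)
        have pK: "p \<theta> \<in> K" using p \<theta> by (simp add: S_def)
        have "norm (\<mu>\<^sup>2 *\<^sub>R f0 (p \<theta>) + \<mu> *\<^sub>R G \<theta> (p \<theta>)) \<le> \<mu>\<^sup>2 * norm (f0 (p \<theta>)) + \<mu> * norm (G \<theta> (p \<theta>))"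
          using norm_triangle_ineq[of "\<mu>\<^sup>2 *\<^sub>R f0 (p \<theta>)" "\<mu> *\<^sub>R G \<theta> (p \<theta>)"] \<mu> by simp
        also have "\<dots> \<le> \<mu> * M' + \<mu> * M'"
          using \<open>\<mu>\<^sup>2 \<le> \<mu>\<close> M(1)[OF pK] M(2)[OF pK, of \<theta>] M' \<mu> by (intro add_mono mult_mono) auto
        finally show "norm (\<mu>\<^sup>2 *\<^sub>R f0 (p \<theta>) + \<mu> *\<^sub>R G \<theta> (p \<theta>)) \<le> \<mu> * (2 * M')" by (simp add: mult_ac)
      qed
      then show ?thesis by (simp add: R_def y_def mult_ac)
    qed
    define P where "P \<theta> = H \<theta> y - H \<theta>0 y" for \<theta>
    have dP: "(P has_vector_derivative G \<theta> y) (at \<theta> within S)" for \<theta>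
      unfolding P_def using H[OF y, of \<theta>]
      by (auto intro!: derivative_eq_intros intro: has_vector_derivative_at_within)
    \<comment> \<open>Subtracting \<open>\<mu> *\<^sub>R P \<theta>\<close> replaces
      \<open>G \<theta> (p \<theta>)\<close> in the derivative by
      \<open>G \<theta> (p \<theta>) - G \<theta> y\<close>. By the Lipschitz condition and
      \<open>near\<close> this difference supplies a second factor \<open>\<mu>\<close>.\<close>
    have near2: "norm (p \<theta> - y - \<mu> *\<^sub>R P \<theta>) \<le> \<mu>\<^sup>2 * R2" if \<theta>: "\<theta> \<in> S" for \<theta>
    proof -
      have "norm ((p \<theta> - \<mu> *\<^sub>R P \<theta>) - (p \<theta>0 - \<mu> *\<^sub>R P \<theta>0)) \<le> (\<mu>\<^sup>2 * (M' + L' * R)) * (2 * pi)"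
      proof (rule bound[OF _ _ \<theta>])
        fix \<theta> assume \<theta>: "\<theta> \<in> S"
        have "(p has_vector_derivative \<mu>\<^sup>2 *\<^sub>R f0 (p \<theta>) + \<mu> *\<^sub>R G \<theta> (p \<theta>)) (at \<theta> within S)"
          using dp \<theta> by (simp add: S_def)
        then show "((\<lambda>\<theta>. p \<theta> - \<mu> *\<^sub>R P \<theta>) has_vector_derivative
            \<mu>\<^sup>2 *\<^sub>R f0 (p \<theta>) + \<mu> *\<^sub>R (G \<theta> (p \<theta>) - G \<theta> y)) (at \<theta> within S)"
          using dP[of \<theta>] by (auto intro!: derivative_eq_intros simp: algebra_simps)
        have pK: "p \<theta> \<in> K" using p \<theta> by (simp add: S_def)
        have "norm (G \<theta> (p \<theta>) - G \<theta> y) \<le> L * norm (p \<theta> - y)" by (rule L[OF y pK])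
        also have "\<dots> \<le> L' * (\<mu> * R)" using near[OF \<theta>] L' by (intro mult_mono) auto
        finally have GL: "norm (G \<theta> (p \<theta>) - G \<theta> y) \<le> L' * (\<mu> * R)" .
        have "norm (\<mu>\<^sup>2 *\<^sub>R f0 (p \<theta>) + \<mu> *\<^sub>R (G \<theta> (p \<theta>) - G \<theta> y))
            \<le> \<mu>\<^sup>2 * norm (f0 (p \<theta>)) + \<mu> * norm (G \<theta> (p \<theta>) - G \<theta> y)"
          using norm_triangle_ineq[of "\<mu>\<^sup>2 *\<^sub>R f0 (p \<theta>)" "\<mu> *\<^sub>R (G \<theta> (p \<theta>) - G \<theta> y)"] \<mu> by simp
        also have "\<dots> \<le> \<mu>\<^sup>2 * M' + \<mu> * (L' * (\<mu> * R))"
          using M(1)[OF pK] M' \<mu> GL by (intro add_mono mult_left_mono) auto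
        finally show "norm (\<mu>\<^sup>2 *\<^sub>R f0 (p \<theta>) + \<mu> *\<^sub>R (G \<theta> (p \<theta>) - G \<theta> y)) \<le> \<mu>\<^sup>2 * (M' + L' * R)"
          by (simp add: power2_eq_square algebra_simps)
      qed
      then show ?thesis by (simp add: R2_def y_def P_def mult_ac algebra_simps)
    qed
    \<comment> \<open>\<open>E'\<close> is the exact derivative of \<open>V\<close> along
      \<open>p\<close>, and \<open>Z'\<close> is its second-order model, whose integral is known
      from \<open>mean0\<close> and \<open>mean1\<close>. The two are compared pointwise.\<close>
    define E' where "E' \<theta> = \<mu>\<^sup>2 * V' (p \<theta>) (f0 (p \<theta>)) + \<mu> * V' (p \<theta>) (G \<theta> (p \<theta>))" for \<theta>
    define Z' where "Z' \<theta> = \<mu>\<^sup>2 * V' y (f0 y) + \<mu> * V' y (G \<theta> y) + \<mu>\<^sup>2 * g' \<theta> y (P \<theta>)" for \<theta>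
    have "(E' has_integral (V (p (\<theta>0 + 2 * pi)) - V (p \<theta>0))) S"
      unfolding S_def
    proof (rule fundamental_theorem_of_calculus)
      fix \<theta> assume \<theta>: "\<theta> \<in> {\<theta>0..\<theta>0 + 2 * pi}"
      have lin: "linear (V' (p \<theta>))" using dV[OF p[OF \<theta>]] by (rule has_derivative_linear)
      have "((V \<circ> p) has_derivative (V' (p \<theta>) \<circ> (\<lambda>h. h *\<^sub>R (\<mu>\<^sup>2 *\<^sub>R f0 (p \<theta>) + \<mu> *\<^sub>R G \<theta> (p \<theta>)))))
          (at \<theta> within {\<theta>0..\<theta>0 + 2 * pi})"
        by (rule diff_chain_within[OF dp[OF \<theta>, unfolded has_vector_derivative_def]
              has_derivative_at_withinI[OF dV[OF p[OF \<theta>]]]])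
      then show "((\<lambda>\<theta>. V (p \<theta>)) has_vector_derivative E' \<theta>) (at \<theta> within {\<theta>0..\<theta>0 + 2 * pi})"
        by (simp add: has_vector_derivative_def o_def E'_def linear_add[OF lin] linear_scale[OF lin])
    qed simp
    moreover have "(Z' has_integral (\<mu>\<^sup>2 * V' y (f0 y) * (2 * pi) + \<mu> * 0 + \<mu>\<^sup>2 * (2 * pi * B y))) S"
      unfolding Z'_def S_def P_def
      by (intro has_integral_add has_integral_mult_right mean0 mean1 y)
        (use has_integral_const_real[of "\<mu>\<^sup>2 * V' y (f0 y)" \<theta>0 "\<theta>0 + 2 * pi"] in \<open>simp add: mult_ac\<close>)
    ultimately have diff: "((\<lambda>\<theta>. E' \<theta> - Z' \<theta>) has_integral
        (V (p (\<theta>0 + 2 * pi)) - V (p \<theta>0) - (\<mu>\<^sup>2 * V' y (f0 y) * (2 * pi) + \<mu> * 0 + \<mu>\<^sup>2 * (2 * pi * B y)))) S"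
      by (rule has_integral_diff)
    have "norm (V (p (\<theta>0 + 2 * pi)) - V (p \<theta>0) - (\<mu>\<^sup>2 * V' y (f0 y) * (2 * pi) + \<mu> * 0 + \<mu>\<^sup>2 * (2 * pi * B y)))
        \<le> (\<mu>\<^sup>2 * \<eta>) * measure lborel S"
      unfolding S_def
    proof (rule has_integral_bound_real[OF _ _ diff[unfolded S_def]])
      fix \<theta> assume "\<theta> \<in> {\<theta>0..\<theta>0 + 2 * pi} - {}"
      then have \<theta>: "\<theta> \<in> S" by (simp add: S_def)
      have pK: "p \<theta> \<in> K" using p \<theta> by (simp add: S_def)
      note lin = g'(1)[OF y, of \<theta>]
      have e1: "\<bar>V' (p \<theta>) (f0 (p \<theta>)) - V' y (f0 y)\<bar> \<le> \<eta> / 3"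
        using near[OF \<theta>] \<mu>' by (intro d1(2)[OF y pK]) linarith
      have "\<bar>V' (p \<theta>) (G \<theta> (p \<theta>)) - V' y (G \<theta> y) - g' \<theta> y (p \<theta> - y)\<bar> \<le> \<eta> / (3 * R) * norm (p \<theta> - y)"
        using near[OF \<theta>] \<mu>' by (intro d2(2)[OF y pK]) linarith
      also have "\<dots> \<le> \<eta> / (3 * R) * (\<mu> * R)" using near[OF \<theta>] \<eta> R by (intro mult_left_mono) auto
      finally have e2: "\<bar>V' (p \<theta>) (G \<theta> (p \<theta>)) - V' y (G \<theta> y) - g' \<theta> y (p \<theta> - y)\<bar> \<le> \<mu> * (\<eta> / 3)"
        using R by (simp add: field_simps)
      have "\<bar>g' \<theta> y (p \<theta> - y - \<mu> *\<^sub>R P \<theta>)\<bar> \<le> C * norm (p \<theta> - y - \<mu> *\<^sub>R P \<theta>)" by (rule g'(2)[OF y])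
      also have "\<dots> \<le> (C' + 1) * (\<mu>\<^sup>2 * R2)" using near2[OF \<theta>] C' by (intro mult_mono) auto
      also have "\<dots> = \<mu> * (\<mu> * ((C' + 1) * R2))" by (simp add: power2_eq_square mult_ac)
      also have "\<dots> \<le> \<mu> * (\<eta> / 3)" using \<mu>'' \<mu> by (intro mult_left_mono) auto
      finally have e3: "\<bar>g' \<theta> y (p \<theta> - y) - \<mu> * g' \<theta> y (P \<theta>)\<bar> \<le> \<mu> * (\<eta> / 3)"
        by (simp add: linear_diff[OF lin] linear_scale[OF lin])
      have "E' \<theta> - Z' \<theta> = \<mu>\<^sup>2 * (V' (p \<theta>) (f0 (p \<theta>)) - V' y (f0 y)) +
          (\<mu> * (V' (p \<theta>) (G \<theta> (p \<theta>)) - V' y (G \<theta> y) - g' \<theta> y (p \<theta> - y)) +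
           \<mu> * (g' \<theta> y (p \<theta> - y) - \<mu> * g' \<theta> y (P \<theta>)))"
        by (simp add: E'_def Z'_def power2_eq_square algebra_simps)
      also have "\<bar>\<dots>\<bar> \<le> \<mu>\<^sup>2 * (\<eta> / 3) + (\<mu> * (\<mu> * (\<eta> / 3)) + \<mu> * (\<mu> * (\<eta> / 3)))"
        by (intro order_trans[OF abs_triangle_ineq] add_mono)
          (use e1 e2 e3 \<mu> in \<open>auto simp: abs_mult intro!: mult_left_mono\<close>)
      also have "\<dots> = \<mu>\<^sup>2 * \<eta>" by (simp add: power2_eq_square)
      finally show "norm (E' \<theta> - Z' \<theta>) \<le> \<mu>\<^sup>2 * \<eta>" by simp
    qed (use \<eta> in auto)
    then show ?thesis by (simp add: S_def y_def algebra_simps abs_le_iff)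
  qed
  ultimately show ?thesis by blast
qed

section \<open>Continuously differentiable maps\<close>

text \<open>
  In finite dimension, continuity of all directional derivatives of a differentiable map already
  gives continuity of the derivative in the operator norm.
\<close>

definition C1_on ::
  "('a::real_normed_vector \<Rightarrow> 'b::real_normed_vector) \<Rightarrow> ('a \<Rightarrow> 'a \<Rightarrow> 'b) \<Rightarrow> 'a set \<Rightarrow> bool" where
  "C1_on f f' U \<longleftrightarrow> (\<forall>x\<in>U. (f has_derivative f' x) (at x)) \<and> (\<forall>v. continuous_on U (\<lambda>x. f' x v))"

lemma C1_onI:
  assumes "\<And>x. x \<in> U \<Longrightarrow> (f has_derivative f' x) (at x)" "\<And>v. continuous_on U (\<lambda>x. f' x v)"
  shows "C1_on f f' U"
  using assms by (simp add: C1_on_def)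

lemma C1_onD:
  assumes "C1_on f f' U"
  shows "x \<in> U \<Longrightarrow> (f has_derivative f' x) (at x)" "continuous_on U (\<lambda>x. f' x v)"
    "x \<in> U \<Longrightarrow> linear (f' x)" "continuous_on U f"
proof -
  show d: "x \<in> U \<Longrightarrow> (f has_derivative f' x) (at x)" for x
    using assms by (auto simp: C1_on_def)
  show "continuous_on U (\<lambda>x. f' x v)" using assms by (auto simp: C1_on_def)
  show "x \<in> U \<Longrightarrow> linear (f' x)" by (rule has_derivative_linear[OF d])
  show "continuous_on U f"
    using d has_derivative_continuous by (metis continuous_at_imp_continuous_on)
qed

lemma linear_eq_sum_Basis:
  fixes v :: "'a::euclidean_space"
  assumes "linear f"
  shows "f v = (\<Sum>b\<in>Basis. (v \<bullet> b) *\<^sub>R f b)"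
proof -
  have "f v = f (\<Sum>b\<in>Basis. (v \<bullet> b) *\<^sub>R b)" by (simp add: euclidean_representation)
  also have "\<dots> = (\<Sum>b\<in>Basis. (v \<bullet> b) *\<^sub>R f b)"
    by (simp add: linear_sum[OF assms] linear_scale[OF assms])
  finally show ?thesis .
qed

lemma norm_linear_le_sum_Basis:
  fixes v :: "'a::euclidean_space"
  assumes "linear f"
  shows "norm (f v) \<le> (\<Sum>b\<in>Basis. norm (f b)) * norm v"
proof -
  have "norm (f v) \<le> (\<Sum>b\<in>Basis. \<bar>v \<bullet> b\<bar> * norm (f b))"
    unfolding linear_eq_sum_Basis[OF assms, of v] by (rule sum_norm_le) simp
  also have "\<dots> \<le> (\<Sum>b\<in>Basis. norm v * norm (f b))"
    by (intro sum_mono mult_right_mono Basis_le_norm) auto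
  finally show ?thesis by (simp add: sum_distrib_left mult.commute)
qed

lemma C1_on_continuous_apply:
  fixes f :: "'a::euclidean_space \<Rightarrow> 'b::real_normed_vector"
  assumes f: "C1_on f f' U" and h: "continuous_on U h"
  shows "continuous_on U (\<lambda>x. f' x (h x))"
proof -
  have "continuous_on U (\<lambda>x. \<Sum>b\<in>Basis. (h x \<bullet> b) *\<^sub>R f' x b)"
    by (intro continuous_on_sum continuous_on_scaleR continuous_on_inner continuous_on_const h C1_onD(2)[OF f])
  then show ?thesis
    by (rule continuous_on_eq) (use linear_eq_sum_Basis[OF C1_onD(3)[OF f]] in metis)
qed

lemma continuous_on_compact_bounded:
  assumes "continuous_on K f" "compact K"
  shows "\<exists>M\<ge>0. \<forall>x\<in>K. norm (f x) \<le> M"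
proof -
  obtain M where "\<forall>x\<in>K. norm (f x) \<le> M"
    using compact_imp_bounded[OF compact_continuous_image[OF assms]] by (auto simp: bounded_iff)
  then show ?thesis by (intro exI[of _ "max M 0"]) (auto intro: order_trans)
qed

lemma C1_on_derivative_bound:
  fixes f :: "'a::euclidean_space \<Rightarrow> 'b::real_normed_vector"
  assumes f: "C1_on f f' U" and K: "compact K" "K \<subseteq> U"
  shows "\<exists>C\<ge>0. \<forall>x\<in>K. \<forall>v. norm (f' x v) \<le> C * norm v"
proof -
  have "continuous_on K (\<lambda>x. \<Sum>b\<in>Basis. norm (f' x b))"
    by (intro continuous_on_sum continuous_on_norm continuous_on_subset[OF C1_onD(2)[OF f] K(2)])
  from continuous_on_compact_bounded[OF this K(1)] obtain C where
    C: "C \<ge> 0" "\<And>x. x \<in> K \<Longrightarrow> norm (\<Sum>b\<in>Basis. norm (f' x b)) \<le> C" by auto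
  have "norm (f' x v) \<le> C * norm v" if "x \<in> K" for x v
  proof -
    have "linear (f' x)" using C1_onD(3)[OF f] K(2) that by blast
    from norm_linear_le_sum_Basis[OF this, of v] have "norm (f' x v) \<le> (\<Sum>b\<in>Basis. norm (f' x b)) * norm v" .
    also have "\<dots> \<le> C * norm v" using C(2)[OF that] by (intro mult_right_mono) auto
    finally show ?thesis .
  qed
  then show ?thesis using C(1) by blast
qed

lemma C1_on_lipschitz:
  fixes f :: "'a::euclidean_space \<Rightarrow> 'b::real_normed_vector"
  assumes f: "C1_on f f' U" and K: "compact K" "K \<subseteq> U" "convex K"
  shows "\<exists>L\<ge>0. \<forall>x\<in>K. \<forall>y\<in>K. norm (f y - f x) \<le> L * norm (y - x)"
proof -
  obtain C where C: "C \<ge> 0" "\<And>x v. x \<in> K \<Longrightarrow> norm (f' x v) \<le> C * norm v"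
    using C1_on_derivative_bound[OF f K(1,2)] by blast
  have "norm (f y - f x) \<le> C * norm (y - x)" if "x \<in> K" "y \<in> K" for x y
  proof (rule differentiable_bound[OF K(3) _ _ that(2,1)])
    show "(f has_derivative f' x) (at x within K)" if "x \<in> K" for x
      using C1_onD(1)[OF f] K(2) that by (blast intro: has_derivative_at_withinI)
    show "onorm (f' x) \<le> C" if "x \<in> K" for x using C that by (intro onorm_bound) auto
  qed
  then show ?thesis using C(1) by blast
qed

text \<open>Each of the finitely many partial derivatives is uniformly continuous on
  \<open>K\<close>. So one radius \<open>d0\<close> serves all points: on the convex set
  \<open>K \<inter> ball x d0\<close> the derivative differs from \<open>f' x\<close> by at most
  \<open>e\<close> in operator norm, with a share \<open>e / N\<close> for each basis vector, and
  the mean value inequality applies.\<close>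

lemma C1_on_remainder:
  fixes f :: "'a::euclidean_space \<Rightarrow> 'b::real_normed_vector"
  assumes f: "C1_on f f' U" and K: "compact K" "K \<subseteq> U" "convex K" and e: "e > 0"
  shows "\<exists>d>0. \<forall>x\<in>K. \<forall>y\<in>K. norm (y - x) < d \<longrightarrow> norm (f y - f x - f' x (y - x)) \<le> e * norm (y - x)"
proof -
  define N where "N = real DIM('a)"
  have N: "N > 0" by (simp add: N_def)
  have "\<forall>b. \<exists>d>0. \<forall>x\<in>K. \<forall>y\<in>K. dist y x < d \<longrightarrow> dist (f' y b) (f' x b) < e / N"
  proof
    fix b
    have "uniformly_continuous_on K (\<lambda>x. f' x b)"
      by (rule compact_uniformly_continuous[OF continuous_on_subset[OF C1_onD(2)[OF f] K(2)] K(1)])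
    from this[unfolded uniformly_continuous_on_def, THEN spec, THEN mp, OF divide_pos_pos[OF e N]]
    show "\<exists>d>0. \<forall>x\<in>K. \<forall>y\<in>K. dist y x < d \<longrightarrow> dist (f' y b) (f' x b) < e / N" .
  qed
  then obtain d where d: "\<And>b. d b > 0"
    "\<And>b x y. x \<in> K \<Longrightarrow> y \<in> K \<Longrightarrow> dist y x < d b \<Longrightarrow> dist (f' y b) (f' x b) < e / N"
    by metis
  define d0 where "d0 = Min (d ` (Basis :: 'a set))"
  have d0: "d0 > 0" "\<And>b. b \<in> (Basis :: 'a set) \<Longrightarrow> d0 \<le> d b" using d(1) by (auto simp: d0_def)
  have "norm (f y - f x - f' x (y - x)) \<le> e * norm (y - x)"
    if xy: "x \<in> K" "y \<in> K" "norm (y - x) < d0" for x y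
  proof -
    define S where "S = K \<inter> ball x d0"
    have "norm (f y - f x - f' x (y - x)) \<le> norm (y - x) * e"
    proof (rule differentiable_bound_linearization[of x y S f f' x e])
      have "x \<in> S" "y \<in> S" "convex S"
        using xy d0 K(3) by (auto simp: S_def dist_norm norm_minus_commute convex_Int)
      then show "x + t *\<^sub>R (y - x) \<in> S" if "t \<in> {0..1}" for t
        using convexD_alt[of S x y t] that by (simp add: algebra_simps)
      show "x \<in> S" by fact
      show "(f has_derivative f' z) (at z within S)" if "z \<in> S" for z
        using C1_onD(1)[OF f] K(2) that by (auto simp: S_def intro: has_derivative_at_withinI)
      show "onorm (f' z - f' x) \<le> e" if z: "z \<in> S" for z
      proof (rule onorm_bound)
        fix v :: 'a
        have lin: "linear (f' z - f' x)"
          unfolding fun_diff_def using C1_onD(3)[OF f] K(2) z xy by (auto simp: S_def intro!: linear_compose_sub)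
        have "norm ((f' z - f' x) b) \<le> e / N" if "b \<in> Basis" for b
          using d(2)[of x z b] d0(2)[OF that] z xy by (auto simp: S_def dist_norm dist_commute fun_diff_def norm_minus_commute)
        then have "(\<Sum>b\<in>Basis. norm ((f' z - f' x) b)) \<le> of_nat DIM('a) * (e / N)"
          by (intro sum_bounded_above) auto
        also have "\<dots> = e" by (simp add: N_def)
        finally have "(\<Sum>b\<in>Basis. norm ((f' z - f' x) b)) * norm v \<le> e * norm v"
          by (intro mult_right_mono) auto
        then show "norm ((f' z - f' x) v) \<le> e * norm v"
          using norm_linear_le_sum_Basis[OF lin, of v] by linarith
      qed (use e in simp)
    qed
    then show ?thesis by (simp add: mult.commute)
  qed
  then show ?thesis using d0(1) by blast
qed

section \<open>Closure rules for continuously differentiable maps\<close>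

lemma C1_on_linear:
  assumes "bounded_linear f"
  shows "C1_on f (\<lambda>_. f) U"
  using assms by (auto simp: C1_on_def intro: bounded_linear_imp_has_derivative)

lemma C1_on_add:
  assumes "C1_on f f' U" "C1_on g g' U"
  shows "C1_on (\<lambda>x. f x + g x) (\<lambda>x h. f' x h + g' x h) U"
  using assms unfolding C1_on_def by (auto intro!: derivative_eq_intros continuous_intros)

lemma C1_on_mult:
  fixes f g :: "'a::real_normed_vector \<Rightarrow> real"
  assumes f: "C1_on f f' U" and g: "C1_on g g' U"
  shows "C1_on (\<lambda>x. f x * g x) (\<lambda>x h. f x * g' x h + f' x h * g x) U"
proof (rule C1_onI)
  show "((\<lambda>x. f x * g x) has_derivative (\<lambda>h. f x * g' x h + f' x h * g x)) (at x)" if "x \<in> U" for x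
    by (rule has_derivative_mult[OF C1_onD(1)[OF f that] C1_onD(1)[OF g that]])
  show "continuous_on U (\<lambda>x. f x * g' x h + f' x h * g x)" for h
    by (intro continuous_on_add continuous_on_mult C1_onD(2)[OF f] C1_onD(2)[OF g] C1_onD(4)[OF f] C1_onD(4)[OF g])
qed

lemma C1_on_cmult:
  fixes f :: "'a::real_normed_vector \<Rightarrow> real"
  assumes "C1_on f f' U"
  shows "C1_on (\<lambda>x. c * f x) (\<lambda>x h. c * f' x h) U"
  using assms unfolding C1_on_def by (auto intro!: derivative_eq_intros continuous_intros)

lemma C1_on_sum:
  assumes "\<And>i. i \<in> I \<Longrightarrow> C1_on (f i) (f' i) U"
  shows "C1_on (\<lambda>x. \<Sum>i\<in>I. f i x) (\<lambda>x h. \<Sum>i\<in>I. f' i x h) U"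
  using assms unfolding C1_on_def by (auto intro!: has_derivative_sum continuous_on_sum)

lemma C1_on_compose_real:
  fixes w :: "'a::real_normed_vector \<Rightarrow> real"
  assumes \<phi>: "\<And>y. (\<phi> has_real_derivative \<phi>' y) (at y)" and \<phi>': "continuous_on UNIV \<phi>'"
    and w: "C1_on w w' U"
  shows "C1_on (\<lambda>x. \<phi> (w x)) (\<lambda>x h. \<phi>' (w x) * w' x h) U"
proof (rule C1_onI)
  show "((\<lambda>x. \<phi> (w x)) has_derivative (\<lambda>h. \<phi>' (w x) * w' x h)) (at x)" if "x \<in> U" for x
    using has_derivative_compose[OF C1_onD(1)[OF w that] \<phi>[of "w x", unfolded has_field_derivative_def]]
    by simp
  show "continuous_on U (\<lambda>x. \<phi>' (w x) * w' x h)" for h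
    by (intro continuous_on_mult C1_onD(2)[OF w] continuous_on_compose2[OF \<phi>' C1_onD(4)[OF w]]) simp
qed

lemma C1_on_fst:
  assumes "C1_on f f' D"
  shows "C1_on (\<lambda>q. f (fst q)) (\<lambda>q h. f' (fst q) (fst h)) (D \<times> UNIV)"
proof (rule C1_onI)
  show "((\<lambda>q. f (fst q)) has_derivative (\<lambda>h. f' (fst q) (fst h))) (at q)" if "q \<in> D \<times> UNIV" for q
  proof (rule has_derivative_compose[where f = fst and f' = fst and g = f])
    show "(fst has_derivative fst) (at q)" by (rule bounded_linear_imp_has_derivative[OF bounded_linear_fst])
    show "(f has_derivative f' (fst q)) (at (fst q))" using that by (intro C1_onD(1)[OF assms]) auto
  qed
  show "continuous_on (D \<times> UNIV) (\<lambda>q. f' (fst q) (fst h))" for h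
    by (rule continuous_on_compose2[OF C1_onD(2)[OF assms] continuous_on_fst[OF continuous_on_id]]) auto
qed

section \<open>Passing from C^2 to C^1 data\<close>

lemma C2_on_real:
  assumes "C2_on \<phi> UNIV"
  shows "(\<phi> has_real_derivative deriv \<phi> y) (at y)" "continuous_on UNIV (deriv \<phi>)"
proof -
  obtain f' f'' where f: "\<And>x. (\<phi> has_derivative blinfun_apply (f' x)) (at x)"
    "\<And>x. (f' has_derivative blinfun_apply (f'' x)) (at x)"
    using assms unfolding C2_on_def by auto
  have D: "(\<phi> has_real_derivative blinfun_apply (f' x) 1) (at x)" for x
  proof -
    have "blinfun_apply (f' x) = (*) (blinfun_apply (f' x) 1)"
    proof
      fix h
      show "blinfun_apply (f' x) h = blinfun_apply (f' x) 1 * h"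
        using linear_scale[OF has_derivative_linear[OF f(1)[of x]], of h 1]
        by (metis mult.commute mult.right_neutral real_scaleR_def)
    qed
    then show ?thesis using f(1)[of x] by (simp add: has_field_derivative_def)
  qed
  then have eq: "deriv \<phi> x = blinfun_apply (f' x) 1" for x by (rule DERIV_imp_deriv)
  show "(\<phi> has_real_derivative deriv \<phi> y) (at y)" using D by (simp add: eq)
  have "continuous_on UNIV f'"
    using f(2) has_derivative_continuous by (metis continuous_at_imp_continuous_on)
  then show "continuous_on UNIV (deriv \<phi>)"
    unfolding eq[abs_def]
    by (rule bounded_bilinear.continuous_on[OF bounded_bilinear_blinfun_apply _ continuous_on_const])
qed

text \<open>\<open>f'' z x h\<close> differentiates \<open>f' x z\<close> in direction
  \<open>h\<close>. Linearity in \<open>h\<close> is implied by the second conclusion; the third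
  adds linearity in \<open>z\<close>, which a family of \<open>C1_on\<close> statements with fixed
  \<open>z\<close> does not express.\<close>

lemma C2_on_C1:
  assumes "C2_on f D"
  obtains f' f'' where "C1_on f f' D" "\<And>z. C1_on (\<lambda>x. f' x z) (f'' z) D" "\<And>x z. linear (\<lambda>h. f'' h x z)"
proof -
  obtain f' f'' where f: "\<And>x. x \<in> D \<Longrightarrow> (f has_derivative blinfun_apply (f' x)) (at x)"
    "\<And>x. x \<in> D \<Longrightarrow> (f' has_derivative blinfun_apply (f'' x)) (at x)" "continuous_on D f''"
    using assms unfolding C2_on_def by auto
  have "continuous_on D f'" using f(2) has_derivative_continuous by (metis continuous_at_imp_continuous_on)
  then have "C1_on f (\<lambda>x. blinfun_apply (f' x)) D"
    using f(1) bounded_bilinear.continuous_on[OF bounded_bilinear_blinfun_apply _ continuous_on_const]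
    by (intro C1_onI) blast+
  moreover have "C1_on (\<lambda>x. blinfun_apply (f' x) z) (\<lambda>x h. blinfun_apply (blinfun_apply (f'' x) h) z) D" for z
  proof (rule C1_onI)
    show "((\<lambda>x. blinfun_apply (f' x) z) has_derivative (\<lambda>h. blinfun_apply (blinfun_apply (f'' x) h) z)) (at x)"
      if "x \<in> D" for x
      using bounded_linear.has_derivative[OF bounded_bilinear.bounded_linear_left[OF bounded_bilinear_blinfun_apply] f(2)[OF that]] .
    show "continuous_on D (\<lambda>x. blinfun_apply (blinfun_apply (f'' x) h) z)" for h
      by (intro bounded_bilinear.continuous_on[OF bounded_bilinear_blinfun_apply _ continuous_on_const] f(3))
  qed
  moreover have "linear (\<lambda>h. blinfun_apply (blinfun_apply (f'' x) z) h)" for x z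
    by (intro bounded_linear.linear blinfun.bounded_linear_right)
  ultimately show ?thesis by (rule that)
qed

section \<open>Oscillating fields\<close>

text \<open>The frequency is an integer because product formulas yield differences of natural
  frequencies, and the window starts at an arbitrary \<open>c\<close> because the initial time is
  arbitrary.\<close>

lemma has_integral_cos_period:
  "((\<lambda>\<theta>. cos (of_int n * \<theta>)) has_integral (if n = 0 then 2 * pi else 0)) {c..c + 2 * pi}"
proof (cases "n = 0")
  case True
  then show ?thesis using has_integral_const_real[of "1::real" c "c + 2 * pi"] by simp
next
  case False
  have "((\<lambda>\<theta>. cos (of_int n * \<theta>)) has_integral
      (sin (of_int n * (c + 2 * pi)) / of_int n - sin (of_int n * c) / of_int n)) {c..c + 2 * pi}"
    by (rule fundamental_theorem_of_calculus)
      (use False in \<open>auto intro!: derivative_eq_intros simp flip: has_real_derivative_iff_has_vector_derivative\<close>)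
  moreover have "sin (of_int n * (c + 2 * pi)) = sin (of_int n * c)"
    using sin_int_2pin[of n] cos_int_2pin[of n] by (simp add: distrib_left sin_add mult_ac)
  ultimately show ?thesis using False by simp
qed

lemma has_integral_sin_period:
  "((\<lambda>\<theta>. sin (of_int n * \<theta>)) has_integral 0) {c..c + 2 * pi}"
proof (cases "n = 0")
  case False
  have "((\<lambda>\<theta>. sin (of_int n * \<theta>)) has_integral
      (- cos (of_int n * (c + 2 * pi)) / of_int n - (- cos (of_int n * c) / of_int n))) {c..c + 2 * pi}"
    by (rule fundamental_theorem_of_calculus)
      (use False in \<open>auto intro!: derivative_eq_intros simp flip: has_real_derivative_iff_has_vector_derivative\<close>)
  moreover have "cos (of_int n * (c + 2 * pi)) = cos (of_int n * c)"
    using sin_int_2pin[of n] cos_int_2pin[of n] by (simp add: distrib_left cos_add mult_ac)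
  ultimately show ?thesis using False by simp
qed simp

lemma trig_orthogonality:
  fixes k j :: nat
  assumes "k > 0" "j > 0"
  shows has_integral_cos_cos: "((\<lambda>\<theta>. cos (real k * \<theta>) * cos (real j * \<theta>)) has_integral
          (if k = j then pi else 0)) {c..c + 2 * pi}"
    and has_integral_sin_sin: "((\<lambda>\<theta>. sin (real k * \<theta>) * sin (real j * \<theta>)) has_integral
          (if k = j then pi else 0)) {c..c + 2 * pi}"
    and has_integral_sin_cos: "((\<lambda>\<theta>. sin (real k * \<theta>) * cos (real j * \<theta>)) has_integral 0) {c..c + 2 * pi}"
    and has_integral_cos_sin: "((\<lambda>\<theta>. cos (real k * \<theta>) * sin (real j * \<theta>)) has_integral 0) {c..c + 2 * pi}"
proof -
  define m p where "m = int k - int j" and "p = int k + int j"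
  have mp: "real k * \<theta> - real j * \<theta> = of_int m * \<theta>" "real k * \<theta> + real j * \<theta> = of_int p * \<theta>" for \<theta>
    by (auto simp: m_def p_def algebra_simps)
  have p: "p \<noteq> 0" and m: "m = 0 \<longleftrightarrow> k = j" using assms by (auto simp: m_def p_def)
  note C = has_integral_cos_period[of m c] has_integral_cos_period[of p c]
  note S = has_integral_sin_period[of m c] has_integral_sin_period[of p c]
  show "((\<lambda>\<theta>. cos (real k * \<theta>) * cos (real j * \<theta>)) has_integral (if k = j then pi else 0)) {c..c + 2 * pi}"
    using has_integral_divide[OF has_integral_add[OF C], of 2] p m
    by (simp add: cos_times_cos mp split: if_splits)
  show "((\<lambda>\<theta>. sin (real k * \<theta>) * sin (real j * \<theta>)) has_integral (if k = j then pi else 0)) {c..c + 2 * pi}"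
    using has_integral_divide[OF has_integral_diff[OF C], of 2] p m
    by (simp add: sin_times_sin mp split: if_splits)
  show "((\<lambda>\<theta>. sin (real k * \<theta>) * cos (real j * \<theta>)) has_integral 0) {c..c + 2 * pi}"
    using has_integral_divide[OF has_integral_add[OF S(2,1)], of 2]
    by (simp add: sin_times_cos mp)
  show "((\<lambda>\<theta>. cos (real k * \<theta>) * sin (real j * \<theta>)) has_integral 0) {c..c + 2 * pi}"
    using has_integral_divide[OF has_integral_diff[OF S(2,1)], of 2]
    by (simp add: cos_times_sin mp)
qed

text \<open>With amplitude \<open>sqrt \<omega>\<close> the oscillation displaces the state by order
  \<open>1 / sqrt \<omega>\<close>; the product of displacement and amplitude is of order 1, so the
  second-order effect survives as \<omega> grows.\<close>

definition oscillating_field ::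
  "('a::real_normed_vector \<Rightarrow> 'a) \<Rightarrow> ('k::finite \<Rightarrow> 'a \<Rightarrow> 'a) \<Rightarrow> ('k \<Rightarrow> 'a \<Rightarrow> 'a) \<Rightarrow> ('k \<Rightarrow> nat) \<Rightarrow>
     real \<Rightarrow> real \<Rightarrow> 'a \<Rightarrow> 'a" where
  "oscillating_field f0 a b m \<omega> t x = f0 x +
     sqrt \<omega> *\<^sub>R (\<Sum>k\<in>UNIV. cos (real (m k) * \<omega> * t) *\<^sub>R a k x + sin (real (m k) * \<omega> * t) *\<^sub>R b k x)"

lemma norm_trig_sum_le:
  fixes u v :: "'k::finite \<Rightarrow> 'a::real_normed_vector"
  assumes "\<And>k. norm (u k) \<le> D k" "\<And>k. norm (v k) \<le> D' k"
  shows "norm (\<Sum>k\<in>UNIV. cos (c k) *\<^sub>R u k + sin (c k) *\<^sub>R v k) \<le> (\<Sum>k\<in>UNIV. D k + D' k)"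
proof (rule sum_norm_le)
  fix k
  have "norm (cos (c k) *\<^sub>R u k + sin (c k) *\<^sub>R v k) \<le> \<bar>cos (c k)\<bar> * norm (u k) + \<bar>sin (c k)\<bar> * norm (v k)"
    by (rule norm_triangle_le) simp
  also have "\<dots> \<le> 1 * D k + 1 * D' k"
    using assms by (intro add_mono mult_mono) auto
  finally show "norm (cos (c k) *\<^sub>R u k + sin (c k) *\<^sub>R v k) \<le> D k + D' k" by simp
qed

text \<open>The inner sum is the antiderivative of the oscillation with coefficients
  \<open>a\<close> and \<open>b\<close>. Expanding by linearity gives a double sum of trigonometric
  products. As the frequencies are distinct, only the cosine-cosine and sine-sine terms with
  \<open>j = k\<close> survive, each with integral \<open>pi\<close>. The constant of integration
  \<open>z\<close> is multiplied by functions of mean zero.\<close>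

lemma trig_sum_bilinear_mean:
  fixes A B :: "'k::finite \<Rightarrow> 'a::real_normed_vector \<Rightarrow> real" and a b :: "'k \<Rightarrow> 'a"
  assumes lin: "\<And>k. linear (A k)" "\<And>k. linear (B k)" and m: "\<And>k. m k > 0" "inj m"
  shows "((\<lambda>\<theta>. \<Sum>k\<in>UNIV.
            cos (real (m k) * \<theta>) * A k ((\<Sum>j\<in>UNIV. (sin (real (m j) * \<theta>) / real (m j)) *\<^sub>R a j - (cos (real (m j) * \<theta>) / real (m j)) *\<^sub>R b j) - z) +
            sin (real (m k) * \<theta>) * B k ((\<Sum>j\<in>UNIV. (sin (real (m j) * \<theta>) / real (m j)) *\<^sub>R a j - (cos (real (m j) * \<theta>) / real (m j)) *\<^sub>R b j) - z))
         has_integral 2 * pi * (\<Sum>k\<in>UNIV. (B k (a k) - A k (b k)) / (2 * real (m k)))) {c..c + 2 * pi}"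
    (is "(?f has_integral _) _")
proof -
  have expand: "F ((\<Sum>j\<in>UNIV. (sin (real (m j) * \<theta>) / real (m j)) *\<^sub>R a j - (cos (real (m j) * \<theta>) / real (m j)) *\<^sub>R b j) - z)
      = (\<Sum>j\<in>UNIV. (sin (real (m j) * \<theta>) / real (m j)) * F (a j) - (cos (real (m j) * \<theta>) / real (m j)) * F (b j)) - F z"
    if "linear F" for F :: "'a \<Rightarrow> real" and \<theta>
    by (simp add: linear_diff[OF that] linear_sum[OF that] linear_scale[OF that])
  have eq: "?f \<theta> = (\<Sum>k\<in>UNIV. (\<Sum>j\<in>UNIV.
       ((cos (real (m k) * \<theta>) * sin (real (m j) * \<theta>)) * (A k (a j) / real (m j)) -
        (cos (real (m k) * \<theta>) * cos (real (m j) * \<theta>)) * (A k (b j) / real (m j))) +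
       ((sin (real (m k) * \<theta>) * sin (real (m j) * \<theta>)) * (B k (a j) / real (m j)) -
        (sin (real (m k) * \<theta>) * cos (real (m j) * \<theta>)) * (B k (b j) / real (m j)))) -
       (cos (real_of_int (int (m k)) * \<theta>) * A k z + sin (real_of_int (int (m k)) * \<theta>) * B k z))" for \<theta>
    unfolding expand[OF lin(1)] expand[OF lin(2)]
    by (simp add: sum_distrib_left right_diff_distrib sum.distrib sum_subtractf mult_ac)
  have m0: "m k \<noteq> 0" for k using m(1)[of k] by simp
  have int: "(?f has_integral (\<Sum>k\<in>UNIV. (\<Sum>j\<in>UNIV.
       (0 * (A k (a j) / real (m j)) - (if m k = m j then pi else 0) * (A k (b j) / real (m j))) +
       ((if m k = m j then pi else 0) * (B k (a j) / real (m j)) - 0 * (B k (b j) / real (m j)))) -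
       ((if int (m k) = 0 then 2 * pi else 0) * A k z + 0 * B k z))) {c..c + 2 * pi}"
    unfolding eq
    by (intro has_integral_sum has_integral_diff has_integral_add has_integral_mult_left finite
        has_integral_cos_cos has_integral_sin_sin has_integral_sin_cos has_integral_cos_sin
        has_integral_cos_period has_integral_sin_period m(1))
  have "(\<Sum>j\<in>UNIV.
       (0 * (A k (a j) / real (m j)) - (if m k = m j then pi else 0) * (A k (b j) / real (m j))) +
       ((if m k = m j then pi else 0) * (B k (a j) / real (m j)) - 0 * (B k (b j) / real (m j))))
     = (\<Sum>j\<in>UNIV. if k = j then pi * ((B k (a j) - A k (b j)) / real (m j)) else 0)" for k
    by (rule sum.cong) (auto simp: inj_eq[OF m(2)] diff_divide_distrib algebra_simps)
  then have "(\<Sum>k\<in>UNIV. (\<Sum>j\<in>UNIV.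
       (0 * (A k (a j) / real (m j)) - (if m k = m j then pi else 0) * (A k (b j) / real (m j))) +
       ((if m k = m j then pi else 0) * (B k (a j) / real (m j)) - 0 * (B k (b j) / real (m j)))) -
       ((if int (m k) = 0 then 2 * pi else 0) * A k z + 0 * B k z))
     = (\<Sum>k\<in>UNIV. pi * ((B k (a k) - A k (b k)) / real (m k)))"
    by (simp add: sum.delta m0)
  also have "\<dots> = 2 * pi * (\<Sum>k\<in>UNIV. (B k (a k) - A k (b k)) / (2 * real (m k)))"
    by (simp add: sum_distrib_left)
  finally show ?thesis using int by simp
qed

text \<open>\<open>gb' k x (a k x)\<close> differentiates along \<open>a k\<close> the derivative of
  \<open>V\<close> along \<open>b k\<close>, and \<open>ga' k x (b k x)\<close> has the roles
  exchanged. Their difference is thus the commutator of two directional derivatives applied to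
  \<open>V\<close>, which is how the Lie bracket enters without a second derivative of
  \<open>V\<close>.\<close>

theorem oscillating_field_practically_asymptotically_stable:
  fixes f0 :: "'a::euclidean_space \<Rightarrow> 'a" and a b :: "'k::finite \<Rightarrow> 'a \<Rightarrow> 'a" and V :: "'a \<Rightarrow> real"
  assumes U: "open U" and r: "r > 0" "cball qs r \<subseteq> U"
    and m: "\<And>k. m k > 0" "inj m"
    and f0: "C1_on f0 f0' U" and a: "\<And>k. C1_on (a k) (a' k) U" and b: "\<And>k. C1_on (b k) (b' k) U"
    and V: "C1_on V V' U"
    and ga: "\<And>k. C1_on (\<lambda>x. V' x (a k x)) (ga' k) U" and gb: "\<And>k. C1_on (\<lambda>x. V' x (b k x)) (gb' k) U"
    and pos: "\<And>x. x \<in> cball qs r \<Longrightarrow> x \<noteq> qs \<Longrightarrow> V qs < V x"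
    and neg: "\<And>x. x \<in> cball qs r \<Longrightarrow> x \<noteq> qs \<Longrightarrow>
      V' x (f0 x) + (\<Sum>k\<in>UNIV. (gb' k x (a k x) - ga' k x (b k x)) / (2 * real (m k))) < 0"
  shows "practically_uniformly_asymptotically_stable (oscillating_field f0 a b m) U qs"
proof -
  define K where "K = cball qs r"
  have K: "compact K" "K \<subseteq> U" "convex K" using r by (auto simp: K_def)
  define A where "A x = V' x (f0 x) + (\<Sum>k\<in>UNIV. (gb' k x (a k x) - ga' k x (b k x)) / (2 * real (m k)))" for x
  define G where "G \<theta> x = (\<Sum>k\<in>UNIV. cos (real (m k) * \<theta>) *\<^sub>R a k x + sin (real (m k) * \<theta>) *\<^sub>R b k x)" for \<theta> x
  \<comment> \<open>The antiderivative of \<open>G\<close> in \<open>\<theta>\<close>; integration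
    is what puts the frequencies into the denominators of the averaged terms.\<close>
  define H where "H \<theta> x = (\<Sum>k\<in>UNIV. (sin (real (m k) * \<theta>) / real (m k)) *\<^sub>R a k x - (cos (real (m k) * \<theta>) / real (m k)) *\<^sub>R b k x)" for \<theta> x
  define g' where "g' \<theta> x v = (\<Sum>k\<in>UNIV. cos (real (m k) * \<theta>) * ga' k x v + sin (real (m k) * \<theta>) * gb' k x v)" for \<theta> x v
  have m0: "m k \<noteq> 0" for k using m(1)[of k] by simp
  have field: "oscillating_field f0 a b m \<omega> t x = f0 x + sqrt \<omega> *\<^sub>R G (\<omega> * t) x" for \<omega> t x
    by (simp add: oscillating_field_def G_def mult.assoc)
  have VG: "V' x (G \<theta> x) = (\<Sum>k\<in>UNIV. cos (real (m k) * \<theta>) * V' x (a k x) + sin (real (m k) * \<theta>) * V' x (b k x))"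
    if "x \<in> U" for \<theta> x
    using C1_onD(3)[OF V that] by (simp add: G_def linear_sum linear_add linear_scale)
  have lipG: "\<exists>L\<ge>0. \<forall>\<theta>. \<forall>x\<in>C. \<forall>y\<in>C. norm (G \<theta> y - G \<theta> x) \<le> L * norm (y - x)"
    if C: "compact C" "C \<subseteq> U" "convex C" for C
  proof -
    obtain La Lb where L: "\<And>k. La k \<ge> 0" "\<And>k x y. x \<in> C \<Longrightarrow> y \<in> C \<Longrightarrow> norm (a k y - a k x) \<le> La k * norm (y - x)"
      "\<And>k. Lb k \<ge> 0" "\<And>k x y. x \<in> C \<Longrightarrow> y \<in> C \<Longrightarrow> norm (b k y - b k x) \<le> Lb k * norm (y - x)"
      using C1_on_lipschitz[OF a C] C1_on_lipschitz[OF b C] by metis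
    have "norm (G \<theta> y - G \<theta> x) \<le> (\<Sum>k\<in>UNIV. La k + Lb k) * norm (y - x)" if "x \<in> C" "y \<in> C" for \<theta> x y
    proof -
      have "G \<theta> y - G \<theta> x = (\<Sum>k\<in>UNIV. cos (real (m k) * \<theta>) *\<^sub>R (a k y - a k x) + sin (real (m k) * \<theta>) *\<^sub>R (b k y - b k x))"
        by (simp add: G_def algebra_simps flip: sum_subtractf)
      also have "norm \<dots> \<le> (\<Sum>k\<in>UNIV. La k * norm (y - x) + Lb k * norm (y - x))"
        using L that by (intro norm_trig_sum_le) auto
      finally show ?thesis by (simp add: sum_distrib_right distrib_right)
    qed
    moreover have "(\<Sum>k\<in>UNIV. La k + Lb k) \<ge> 0" using L by (intro sum_nonneg add_nonneg_nonneg)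
    ultimately show ?thesis by blast
  qed
  have boundG: "\<exists>M\<ge>0. \<forall>\<theta>. \<forall>x\<in>C. norm (f0 x) \<le> M \<and> norm (G \<theta> x) \<le> M" if C: "compact C" "C \<subseteq> U" for C
  proof -
    have cont: "continuous_on C (a k)" "continuous_on C (b k)" "continuous_on C f0" for k
      using C1_onD(4)[OF a] C1_onD(4)[OF b] C1_onD(4)[OF f0] C(2) continuous_on_subset by blast+
    obtain Ma Mb M0 where M: "\<And>k x. x \<in> C \<Longrightarrow> norm (a k x) \<le> Ma k" "\<And>k x. x \<in> C \<Longrightarrow> norm (b k x) \<le> Mb k"
      "M0 \<ge> 0" "\<And>x. x \<in> C \<Longrightarrow> norm (f0 x) \<le> M0"
      using continuous_on_compact_bounded[OF cont(1) C(1)] continuous_on_compact_bounded[OF cont(2) C(1)]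
        continuous_on_compact_bounded[OF cont(3) C(1)] by metis
    have "norm (G \<theta> x) \<le> (\<Sum>k\<in>UNIV. Ma k + Mb k)" if "x \<in> C" for \<theta> x
      unfolding G_def using M that by (intro norm_trig_sum_le) auto
    then show ?thesis using M(3,4)
      by (intro exI[of _ "max M0 (\<Sum>k\<in>UNIV. Ma k + Mb k)"]) (auto simp: le_max_iff_disj)
  qed
  have drift: "continuous_on U (\<lambda>x. V' x (f0 x))"
    by (rule C1_on_continuous_apply[OF V C1_onD(4)[OF f0]])
  have contA: "continuous_on U A"
    unfolding A_def
    by (intro continuous_on_add continuous_on_sum continuous_on_divide continuous_on_diff drift
        C1_on_continuous_apply[OF ga] C1_on_continuous_apply[OF gb] C1_onD(4)[OF a] C1_onD(4)[OF b]
        continuous_on_const) (use m(1) in auto)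
  obtain M where M: "M \<ge> 0" "\<And>\<theta> x. x \<in> K \<Longrightarrow> norm (f0 x) \<le> M" "\<And>\<theta> x. x \<in> K \<Longrightarrow> norm (G \<theta> x) \<le> M"
    using boundG[OF K(1,2)] by metis
  show ?thesis
  proof (rule practical_asymptotic_stability_of_period_decrease[where r = r and V = V and A = A
        and T = "2 * pi" and C = "2 * M"])
    show "r > 0" by fact
    show "continuous_on (cball qs r) V" "continuous_on (cball qs r) A"
      using C1_onD(4)[OF V] contA r(2) continuous_on_subset by blast+
    show "V qs < V x" if "x \<in> cball qs r" "x \<noteq> qs" for x using pos that .
    show "A x < 0" if "x \<in> cball qs r" "x \<noteq> qs" for x using neg[OF that] by (simp add: A_def)
    show "2 * pi > 0" by simp
    show "norm (oscillating_field f0 a b m \<omega> t x) \<le> 2 * M * sqrt \<omega>"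
      if "1 \<le> \<omega>" "x \<in> cball qs r" for \<omega> t x
    proof -
      have "norm (oscillating_field f0 a b m \<omega> t x) \<le> norm (f0 x) + sqrt \<omega> * norm (G (\<omega> * t) x)"
        unfolding field by (rule norm_triangle_le) (use that in simp)
      also have "\<dots> \<le> sqrt \<omega> * M + sqrt \<omega> * M"
      proof (rule add_mono)
        have "norm (f0 x) \<le> 1 * M" using M(2)[of x] that by (simp add: K_def)
        also have "\<dots> \<le> sqrt \<omega> * M" using that M(1) by (intro mult_right_mono) auto
        finally show "norm (f0 x) \<le> sqrt \<omega> * M" .
        show "sqrt \<omega> * norm (G (\<omega> * t) x) \<le> sqrt \<omega> * M"
          using that M(3)[of x] by (intro mult_left_mono) (auto simp: K_def)
      qed
      finally show ?thesis by simp
    qed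
    show "\<exists>\<omega>0. \<forall>\<omega>>\<omega>0. \<forall>s q. (\<forall>t\<in>{s..s + 2 * pi/\<omega>}. q t \<in> cball qs r \<and>
          (q has_vector_derivative oscillating_field f0 a b m \<omega> t (q t)) (at t within {s..s + 2 * pi/\<omega>})) \<longrightarrow>
       V (q (s + 2 * pi/\<omega>)) \<le> V (q s) + 2 * pi/\<omega> * (A (q s) + \<eta>)" if \<eta>: "\<eta> > 0" for \<eta>
    proof -
      obtain L where L: "\<And>\<theta> x y. x \<in> K \<Longrightarrow> y \<in> K \<Longrightarrow> norm (G \<theta> y - G \<theta> x) \<le> L * norm (y - x)"
        using lipG[OF K] by blast
      obtain Ca Cb where C: "\<And>k x v. x \<in> K \<Longrightarrow> norm (ga' k x v) \<le> Ca k * norm v"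
        "\<And>k x v. x \<in> K \<Longrightarrow> norm (gb' k x v) \<le> Cb k * norm v"
        using C1_on_derivative_bound[OF ga K(1,2)] C1_on_derivative_bound[OF gb K(1,2)] by metis
      have "\<exists>\<mu>0>0. \<forall>\<mu> \<theta>0 p. 0 < \<mu> \<and> \<mu> < \<mu>0 \<and> (\<forall>\<theta>\<in>{\<theta>0..\<theta>0 + 2 * pi}. p \<theta> \<in> K \<and>
          (p has_vector_derivative \<mu>\<^sup>2 *\<^sub>R f0 (p \<theta>) + \<mu> *\<^sub>R G \<theta> (p \<theta>)) (at \<theta> within {\<theta>0..\<theta>0 + 2 * pi})) \<longrightarrow>
          V (p (\<theta>0 + 2 * pi)) \<le> V (p \<theta>0) + 2 * pi * \<mu>\<^sup>2 * (V' (p \<theta>0) (f0 (p \<theta>0)) +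
            (\<Sum>k\<in>UNIV. (gb' k (p \<theta>0) (a k (p \<theta>0)) - ga' k (p \<theta>0) (b k (p \<theta>0))) / (2 * real (m k))) + \<eta>)"
      proof (rule averaging_over_period[where g' = g' and H = H and C = "\<Sum>k\<in>UNIV. Ca k + Cb k" and M = M and L = L
            and K = K])
        show "(V has_derivative V' x) (at x)" if "x \<in> K" for x
          using C1_onD(1)[OF V] K(2) that by blast
        show "norm (f0 x) \<le> M" "norm (G \<theta> x) \<le> M" if "x \<in> K" for x \<theta> using M that by auto
        show "norm (G \<theta> y - G \<theta> x) \<le> L * norm (y - x)" if "x \<in> K" "y \<in> K" for \<theta> x y using L that .
        show "uniformly_continuous_on K (\<lambda>x. V' x (f0 x))"
          by (rule compact_uniformly_continuous[OF continuous_on_subset[OF drift K(2)] K(1)])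
        have lin: "linear (ga' k x)" "linear (gb' k x)" if "x \<in> K" for k x
          using C1_onD(3)[OF ga] C1_onD(3)[OF gb] K(2) that by blast+
        show "linear (g' \<theta> x)" if "x \<in> K" for \<theta> x
          unfolding g'_def using lin[OF that]
          by (intro linearI) (simp_all add: linear_add linear_scale sum.distrib sum_distrib_left algebra_simps)
        show "\<bar>g' \<theta> x v\<bar> \<le> (\<Sum>k\<in>UNIV. Ca k + Cb k) * norm v" if "x \<in> K" for \<theta> x v
          using norm_trig_sum_le[of "\<lambda>k. ga' k x v" "\<lambda>k. Ca k * norm v" "\<lambda>k. gb' k x v" "\<lambda>k. Cb k * norm v"
              "\<lambda>k. real (m k) * \<theta>"] C[OF that]
          by (simp add: g'_def sum_distrib_right distrib_right)
        show "\<exists>d>0. \<forall>\<theta>. \<forall>x\<in>K. \<forall>y\<in>K. norm (y - x) < d \<longrightarrow>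
            \<bar>V' y (G \<theta> y) - V' x (G \<theta> x) - g' \<theta> x (y - x)\<bar> \<le> e * norm (y - x)" if e: "e > 0" for e
        proof -
          \<comment> \<open>Each of the \<open>2 * N\<close> fields receives an equal share of
            \<open>e\<close>.\<close>
          define N where "N = real CARD('k)"
          have N: "N > 0" by (simp add: N_def)
          have "e / (2 * N) > 0" using e N by simp
          from C1_on_remainder[OF ga K this] C1_on_remainder[OF gb K this]
          obtain da db where d: "\<And>k. da k > 0" "\<And>k. db k > 0"
            "\<And>k x y. x \<in> K \<Longrightarrow> y \<in> K \<Longrightarrow> norm (y - x) < da k \<Longrightarrow>
              norm (V' y (a k y) - V' x (a k x) - ga' k x (y - x)) \<le> e / (2 * N) * norm (y - x)"
            "\<And>k x y. x \<in> K \<Longrightarrow> y \<in> K \<Longrightarrow> norm (y - x) < db k \<Longrightarrow>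
              norm (V' y (b k y) - V' x (b k x) - gb' k x (y - x)) \<le> e / (2 * N) * norm (y - x)"
            by metis
          define d0 where "d0 = Min (range (\<lambda>k. min (da k) (db k)))"
          have d0: "d0 > 0" using d(1,2) by (auto simp: d0_def)
          have "d0 \<le> min (da k) (db k)" for k unfolding d0_def by (rule Min_le) auto
          then have d0_le: "d0 \<le> da k" "d0 \<le> db k" for k by auto
          have "\<bar>V' y (G \<theta> y) - V' x (G \<theta> x) - g' \<theta> x (y - x)\<bar> \<le> e * norm (y - x)"
            if xy: "x \<in> K" "y \<in> K" "norm (y - x) < d0" for x y \<theta>
          proof -
            have eq: "V' y (G \<theta> y) - V' x (G \<theta> x) - g' \<theta> x (y - x) = (\<Sum>k\<in>UNIV.
                cos (real (m k) * \<theta>) *\<^sub>R (V' y (a k y) - V' x (a k x) - ga' k x (y - x)) +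
                sin (real (m k) * \<theta>) *\<^sub>R (V' y (b k y) - V' x (b k x) - gb' k x (y - x)))"
              using xy K(2) by (simp add: VG subsetD g'_def algebra_simps flip: sum_subtractf)
            have "norm (V' y (G \<theta> y) - V' x (G \<theta> x) - g' \<theta> x (y - x)) \<le> (\<Sum>k\<in>(UNIV :: 'k set). e / (2 * N) * norm (y - x) + e / (2 * N) * norm (y - x))"
              unfolding eq by (intro norm_trig_sum_le d(3,4) xy) (use xy d0_le in \<open>meson less_le_trans\<close>)+
            also have "\<dots> = e * norm (y - x)" using N by (simp add: N_def field_simps)
            finally show ?thesis by simp
          qed
          then show ?thesis using d0 by blast
        qed
        show "((\<lambda>\<theta>. H \<theta> x) has_vector_derivative G \<theta> x) (at \<theta>)" for \<theta> x
          unfolding H_def G_def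
          by (rule has_vector_derivative_sum) (auto intro!: derivative_eq_intros simp: field_simps m0)
        show "((\<lambda>\<theta>. V' x (G \<theta> x)) has_integral 0) {\<theta>0..\<theta>0 + 2 * pi}" if "x \<in> K" for \<theta>0 x
        proof -
          have xU: "x \<in> U" using K(2) that by blast
          have "((\<lambda>\<theta>. \<Sum>k\<in>UNIV. cos (real_of_int (int (m k)) * \<theta>) * V' x (a k x) + sin (real_of_int (int (m k)) * \<theta>) * V' x (b k x))
              has_integral (\<Sum>k\<in>UNIV. (if int (m k) = 0 then 2 * pi else 0) * V' x (a k x) + 0 * V' x (b k x))) {\<theta>0..\<theta>0 + 2 * pi}"
            by (intro has_integral_sum has_integral_add has_integral_mult_left has_integral_cos_period has_integral_sin_period finite)
          then show ?thesis by (simp add: VG[OF xU] m0)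
        qed
        show "((\<lambda>\<theta>. g' \<theta> x (H \<theta> x - H \<theta>0 x)) has_integral
            2 * pi * (\<Sum>k\<in>UNIV. (gb' k x (a k x) - ga' k x (b k x)) / (2 * real (m k)))) {\<theta>0..\<theta>0 + 2 * pi}"
          if "x \<in> K" for \<theta>0 x
          unfolding g'_def using trig_sum_bilinear_mean[where a = "\<lambda>k. a k x" and b = "\<lambda>k. b k x" and z = "H \<theta>0 x" and c = \<theta>0,
              OF lin[OF that] m]
          unfolding H_def .
      qed (rule \<eta>)
      then obtain \<mu>0 where \<mu>0: "\<mu>0 > 0" "\<And>\<mu> \<theta>0 p. 0 < \<mu> \<Longrightarrow> \<mu> < \<mu>0 \<Longrightarrow>
          (\<And>\<theta>. \<theta> \<in> {\<theta>0..\<theta>0 + 2 * pi} \<Longrightarrow> p \<theta> \<in> K \<and>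
          (p has_vector_derivative \<mu>\<^sup>2 *\<^sub>R f0 (p \<theta>) + \<mu> *\<^sub>R G \<theta> (p \<theta>)) (at \<theta> within {\<theta>0..\<theta>0 + 2 * pi})) \<Longrightarrow>
          V (p (\<theta>0 + 2 * pi)) \<le> V (p \<theta>0) + 2 * pi * \<mu>\<^sup>2 * (A (p \<theta>0) + \<eta>)"
        unfolding A_def by blast
      show ?thesis
      \<comment> \<open>For \<open>\<mu> = 1 / sqrt \<omega>\<close> the threshold says
        \<open>\<mu> < \<mu>0\<close>. In the time \<open>\<theta> = \<omega> * t\<close> a window
        of length \<open>2 * pi / \<omega>\<close> becomes a common period of all inputs, whatever
        its starting point, since the frequencies are natural numbers.\<close>
      proof (intro exI[of _ "max 1 (1 / \<mu>0\<^sup>2)"] allI impI)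
        fix \<omega> s :: real and q
        assume \<omega>: "max 1 (1 / \<mu>0\<^sup>2) < \<omega>"
          and q: "\<forall>t\<in>{s..s + 2 * pi/\<omega>}. q t \<in> cball qs r \<and>
            (q has_vector_derivative oscillating_field f0 a b m \<omega> t (q t)) (at t within {s..s + 2 * pi/\<omega>})"
        have \<omega>0: "\<omega> > 0" using \<omega> by simp
        define \<mu> where "\<mu> = 1 / sqrt \<omega>"
        have \<mu>: "\<mu> > 0" "\<mu>\<^sup>2 = 1 / \<omega>" "\<mu> * sqrt \<omega> = 1" using \<omega>0 by (auto simp: \<mu>_def power_divide)
        have "\<mu>\<^sup>2 < \<mu>0\<^sup>2" using \<omega> \<omega>0 \<mu>0(1) by (simp add: \<mu> field_simps)
        then have "\<mu> < \<mu>0" using \<mu>0(1) power2_less_imp_less[of \<mu> \<mu>0] by simp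
        define p where "p \<theta> = q (\<theta> / \<omega>)" for \<theta>
        have "p \<theta> \<in> K \<and> (p has_vector_derivative \<mu>\<^sup>2 *\<^sub>R f0 (p \<theta>) + \<mu> *\<^sub>R G \<theta> (p \<theta>))
            (at \<theta> within {\<omega> * s..\<omega> * s + 2 * pi})" if \<theta>: "\<theta> \<in> {\<omega> * s..\<omega> * s + 2 * pi}" for \<theta>
        proof
          have t: "\<theta> / \<omega> \<in> {s..s + 2 * pi/\<omega>}" if "\<theta> \<in> {\<omega> * s..\<omega> * s + 2 * pi}" for \<theta>
            using that \<omega>0 by (auto simp: field_simps)
          show "p \<theta> \<in> K" using q t[OF \<theta>] by (auto simp: p_def K_def)
          have img: "(\<lambda>\<theta>. \<theta> / \<omega>) ` {\<omega> * s..\<omega> * s + 2 * pi} \<subseteq> {s..s + 2 * pi/\<omega>}" using t by blast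
          have "((q \<circ> (\<lambda>\<theta>. \<theta> / \<omega>)) has_vector_derivative
              (1 / \<omega>) *\<^sub>R oscillating_field f0 a b m \<omega> (\<theta> / \<omega>) (q (\<theta> / \<omega>)))
              (at \<theta> within {\<omega> * s..\<omega> * s + 2 * pi})"
          proof (rule vector_diff_chain_within)
            show "((\<lambda>\<theta>. \<theta> / \<omega>) has_vector_derivative 1 / \<omega>) (at \<theta> within {\<omega> * s..\<omega> * s + 2 * pi})"
              using \<omega>0 by (auto intro!: derivative_eq_intros simp flip: has_real_derivative_iff_has_vector_derivative)
            show "(q has_vector_derivative oscillating_field f0 a b m \<omega> (\<theta> / \<omega>) (q (\<theta> / \<omega>)))
                (at (\<theta> / \<omega>) within (\<lambda>\<theta>. \<theta> / \<omega>) ` {\<omega> * s..\<omega> * s + 2 * pi})"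
              using q t[OF \<theta>] by (intro has_vector_derivative_within_subset[OF _ img]) auto
          qed
          moreover have "(1 / \<omega>) *\<^sub>R oscillating_field f0 a b m \<omega> (\<theta> / \<omega>) (q (\<theta> / \<omega>)) = \<mu>\<^sup>2 *\<^sub>R f0 (p \<theta>) + \<mu> *\<^sub>R G \<theta> (p \<theta>)"
          proof -
            have "\<mu>\<^sup>2 * sqrt \<omega> = \<mu>" using \<mu>(3) by (simp add: power2_eq_square mult.assoc)
            then show ?thesis using \<omega>0 by (simp add: field p_def scaleR_add_right flip: \<mu>(2))
          qed
          ultimately show "(p has_vector_derivative \<mu>\<^sup>2 *\<^sub>R f0 (p \<theta>) + \<mu> *\<^sub>R G \<theta> (p \<theta>))
              (at \<theta> within {\<omega> * s..\<omega> * s + 2 * pi})" by (simp add: o_def p_def[abs_def])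
        qed
        from \<mu>0(2)[OF \<mu>(1) \<open>\<mu> < \<mu>0\<close> this]
        have "V (p (\<omega> * s + 2 * pi)) \<le> V (p (\<omega> * s)) + 2 * pi * \<mu>\<^sup>2 * (A (p (\<omega> * s)) + \<eta>)" by blast
        moreover have "(\<omega> * s + 2 * pi) / \<omega> = s + 2 * pi / \<omega>" "\<omega> * s / \<omega> = s" using \<omega>0 by (auto simp: field_simps)
        ultimately show "V (q (s + 2 * pi/\<omega>)) \<le> V (q s) + 2 * pi/\<omega> * (A (q s) + \<eta>)"
          by (simp add: p_def \<mu>(2))
      qed
    qed
    show "I = {t0..}" if \<omega>: "\<omega> > 0" and max: "maximal_solution_on (oscillating_field f0 a b m \<omega>) U t0 I q"
      and qI: "q ` I \<subseteq> cball qs r" for \<omega> t0 I q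
    proof (rule maximal_solution_in_compact[OF max K(1,2)])
      have field_bound: "norm (oscillating_field f0 a b m \<omega> t x) \<le> M + sqrt \<omega> * M"
        if "norm (f0 x) \<le> M" "\<And>\<theta>. norm (G \<theta> x) \<le> M" for t x M
        unfolding field by (rule norm_triangle_mono) (use that \<omega> in \<open>auto intro!: mult_left_mono\<close>)
      show "q ` I \<subseteq> K" using qI by (simp add: K_def)
      show "norm (oscillating_field f0 a b m \<omega> t x) \<le> M + sqrt \<omega> * M" if "x \<in> K" for t x
        using M that by (intro field_bound) auto
      have cont: "continuous_on (UNIV \<times> U) (\<lambda>z. a k (snd z))" "continuous_on (UNIV \<times> U) (\<lambda>z. b k (snd z))"
        "continuous_on (UNIV \<times> U) (\<lambda>z. f0 (snd z))" for k
        using C1_onD(4)[OF a] C1_onD(4)[OF b] C1_onD(4)[OF f0]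
        by (auto intro!: continuous_on_compose2[OF _ continuous_on_snd[OF continuous_on_id]])
      have "continuous_on (UNIV \<times> U) (\<lambda>z. oscillating_field f0 a b m \<omega> (fst z) (snd z))"
        unfolding oscillating_field_def
        by (intro continuous_on_add continuous_on_sum continuous_on_scaleR cont continuous_on_const
            continuous_on_cos continuous_on_sin continuous_on_mult continuous_on_fst continuous_on_id)
      then show "continuous_on (UNIV \<times> U) (\<lambda>(t, x). oscillating_field f0 a b m \<omega> t x)"
        by (simp add: case_prod_beta)
      fix x assume "x \<in> K"
      \<comment> \<open>A ball around a boundary point of \<open>K\<close> leaves \<open>K\<close>,
        so the constants for Picard existence are taken anew on a ball in \<open>U\<close>.\<close>
      then obtain \<rho> where \<rho>: "\<rho> > 0" "cball x \<rho> \<subseteq> U"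
        using U K(2) open_contains_cball by blast
      obtain L1 where L1: "L1 \<ge> 0" "\<And>y z. y \<in> cball x \<rho> \<Longrightarrow> z \<in> cball x \<rho> \<Longrightarrow> norm (f0 z - f0 y) \<le> L1 * norm (z - y)"
        using C1_on_lipschitz[OF f0 compact_cball \<rho>(2) convex_cball] by blast
      obtain L2 where L2: "L2 \<ge> 0" "\<And>\<theta> y z. y \<in> cball x \<rho> \<Longrightarrow> z \<in> cball x \<rho> \<Longrightarrow> norm (G \<theta> z - G \<theta> y) \<le> L2 * norm (z - y)"
        using lipG[OF compact_cball \<rho>(2) convex_cball] by blast
      obtain M1 where M1: "\<And>\<theta> y. y \<in> cball x \<rho> \<Longrightarrow> norm (f0 y) \<le> M1 \<and> norm (G \<theta> y) \<le> M1"
        using boundG[OF compact_cball \<rho>(2)] by blast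
      have "norm (oscillating_field f0 a b m \<omega> t y - oscillating_field f0 a b m \<omega> t z) \<le> (L1 + sqrt \<omega> * L2) * norm (y - z)"
        if yz: "y \<in> cball x \<rho>" "z \<in> cball x \<rho>" for t y z
      proof -
        have "oscillating_field f0 a b m \<omega> t y - oscillating_field f0 a b m \<omega> t z =
            (f0 y - f0 z) + sqrt \<omega> *\<^sub>R (G (\<omega> * t) y - G (\<omega> * t) z)" by (simp add: field algebra_simps)
        also have "norm \<dots> \<le> L1 * norm (y - z) + sqrt \<omega> * (L2 * norm (y - z))"
          by (rule norm_triangle_mono) (use L1(2)[OF yz(2,1)] L2(2)[OF yz(2,1)] \<omega> in \<open>auto intro!: mult_left_mono\<close>)
        finally show ?thesis by (simp add: algebra_simps)
      qed
      moreover have "norm (oscillating_field f0 a b m \<omega> t y) \<le> M1 + sqrt \<omega> * M1" if "y \<in> cball x \<rho>" for t y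
        using M1[OF that] by (intro field_bound) auto
      ultimately show "\<exists>\<rho>>0. cball x \<rho> \<subseteq> U \<and> (\<exists>L M. \<forall>t. (\<forall>y\<in>cball x \<rho>. norm (oscillating_field f0 a b m \<omega> t y) \<le> M) \<and>
          (\<forall>y\<in>cball x \<rho>. \<forall>z\<in>cball x \<rho>. norm (oscillating_field f0 a b m \<omega> t y - oscillating_field f0 a b m \<omega> t z) \<le> L * norm (y - z)))"
        using \<rho> by blast
    qed
  qed
qed

text \<open>For fields with constant directions the product rule splits the commutator. The terms
  with \<open>V''\<close> cancel by symmetry, and those with a derivative of \<open>u\<close> or
  \<open>v\<close> remain. Symmetry is assumed only for the pairs \<open>d k\<close>,
  \<open>e k\<close>; in the application these coincide or lie in complementary blocks, so that it
  can be checked directly.\<close>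

corollary oscillating_directional_field_practically_asymptotically_stable:
  fixes f0 :: "'a::euclidean_space \<Rightarrow> 'a" and u v :: "'k::finite \<Rightarrow> 'a \<Rightarrow> real" and d e :: "'k \<Rightarrow> 'a"
    and V :: "'a \<Rightarrow> real"
  assumes U: "open U" and r: "r > 0" "cball qs r \<subseteq> U"
    and m: "\<And>k. m k > 0" "inj m"
    and f0: "C1_on f0 f0' U" and u: "\<And>k. C1_on (u k) (u' k) U" and v: "\<And>k. C1_on (v k) (v' k) U"
    and V: "C1_on V V' U" and V': "\<And>z. C1_on (\<lambda>x. V' x z) (V'' z) U"
    and sym: "\<And>k x. x \<in> U \<Longrightarrow> V'' (d k) x (e k) = V'' (e k) x (d k)"
    and pos: "\<And>x. x \<in> cball qs r \<Longrightarrow> x \<noteq> qs \<Longrightarrow> V qs < V x"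
    and neg: "\<And>x. x \<in> cball qs r \<Longrightarrow> x \<noteq> qs \<Longrightarrow> V' x (f0 x) + (\<Sum>k\<in>UNIV.
       (u k x * v' k x (d k) * V' x (e k) - v k x * u' k x (e k) * V' x (d k)) / (2 * real (m k))) < 0"
  shows "practically_uniformly_asymptotically_stable
     (oscillating_field f0 (\<lambda>k x. u k x *\<^sub>R d k) (\<lambda>k x. v k x *\<^sub>R e k) m) U qs"
proof -
  have C1_scale: "C1_on (\<lambda>x. p x *\<^sub>R z) (\<lambda>x h. p' x h *\<^sub>R z) U" if "C1_on p p' U" for p p' z
    using that unfolding C1_on_def by (auto intro!: derivative_eq_intros continuous_intros)
  have C1_pair: "C1_on (\<lambda>x. V' x (p x *\<^sub>R z)) (\<lambda>x h. p x * V'' z x h + p' x h * V' x z) U"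
    if p: "C1_on p p' U" for p p' z
  proof (rule C1_onI)
    fix x assume x: "x \<in> U"
    have "((\<lambda>x. p x * V' x z) has_derivative (\<lambda>h. p x * V'' z x h + p' x h * V' x z)) (at x)"
      by (rule has_derivative_mult[OF C1_onD(1)[OF p x] C1_onD(1)[OF V' x]])
    then show "((\<lambda>x. V' x (p x *\<^sub>R z)) has_derivative (\<lambda>h. p x * V'' z x h + p' x h * V' x z)) (at x)"
      by (rule has_derivative_transform_within_open[OF _ U x])
        (simp add: linear_scale[OF C1_onD(3)[OF V]])
  next
    show "continuous_on U (\<lambda>x. p x * V'' z x h + p' x h * V' x z)" for h
      by (intro continuous_on_add continuous_on_mult C1_onD(2)[OF V'] C1_onD(2)[OF p] C1_onD(4)[OF V'] C1_onD(4)[OF p])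
  qed
  show ?thesis
  proof (rule oscillating_field_practically_asymptotically_stable[OF U r m f0 C1_scale[OF u] C1_scale[OF v] V
        C1_pair[OF u] C1_pair[OF v] pos])
    fix x assume x: "x \<in> cball qs r" "x \<noteq> qs"
    have xU: "x \<in> U" using x r by blast
    have "(v k x * V'' (e k) x (u k x *\<^sub>R d k) + v' k x (u k x *\<^sub>R d k) * V' x (e k) -
          (u k x * V'' (d k) x (v k x *\<^sub>R e k) + u' k x (v k x *\<^sub>R e k) * V' x (d k))) =
        u k x * v' k x (d k) * V' x (e k) - v k x * u' k x (e k) * V' x (d k)" for k
      using linear_scale[OF C1_onD(3)[OF V' xU]] linear_scale[OF C1_onD(3)[OF u xU]]
        linear_scale[OF C1_onD(3)[OF v xU]] sym[OF xU]
      by (simp add: algebra_simps)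
    then show "V' x (f0 x) + (\<Sum>k\<in>UNIV. (v k x * V'' (e k) x (u k x *\<^sub>R d k) + v' k x (u k x *\<^sub>R d k) * V' x (e k) -
          (u k x * V'' (d k) x (v k x *\<^sub>R e k) + u' k x (v k x *\<^sub>R e k) * V' x (d k))) / (2 * real (m k))) < 0"
      using neg[OF x] by simp
  qed
qed

section \<open>The extremum seeking system\<close>

lemma sum_UNIV_sum_type:
  fixes f :: "'a::finite + 'b::finite \<Rightarrow> 'c::comm_monoid_add"
  shows "(\<Sum>k\<in>UNIV. f k) = (\<Sum>i\<in>UNIV. f (Inl i)) + (\<Sum>j\<in>UNIV. f (Inr j))"
  by (simp flip: UNIV_Plus_UNIV add: sum.Plus)

lemma sum_scaleR_axis:
  fixes s :: "'n::finite \<Rightarrow> real"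
  shows "(\<Sum>i\<in>UNIV. s i *\<^sub>R (axis i 1, 0 :: real ^ 'n)) = (\<chi> i. s i, 0)"
    "(\<Sum>i\<in>UNIV. s i *\<^sub>R (0 :: real ^ 'n, axis i 1)) = (0, \<chi> i. s i)"
proof -
  have "(\<Sum>i\<in>UNIV. s i *\<^sub>R axis i 1) = (\<chi> i. s i)"
    using basis_expansion[of "\<chi> i. s i"] by (simp add: scalar_mult_eq_scaleR)
  then show "(\<Sum>i\<in>UNIV. s i *\<^sub>R (axis i 1, 0 :: real ^ 'n)) = (\<chi> i. s i, 0)"
    "(\<Sum>i\<in>UNIV. s i *\<^sub>R (0 :: real ^ 'n, axis i 1)) = (0, \<chi> i. s i)"
    by (auto simp: prod_eq_iff fst_sum snd_sum)
qed

lemma inverse_sqrt_C1: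
  assumes "\<epsilon> > 0"
  shows "((\<lambda>y. 1 / sqrt (y\<^sup>2 + \<epsilon>)) has_real_derivative - y / ((y\<^sup>2 + \<epsilon>) * sqrt (y\<^sup>2 + \<epsilon>))) (at y)"
    "continuous_on UNIV (\<lambda>y. - y / ((y\<^sup>2 + \<epsilon>) * sqrt (y\<^sup>2 + \<epsilon>)))"
proof -
  have p: "y\<^sup>2 + \<epsilon> > 0" for y using assms by (simp add: add_nonneg_pos)
  show "((\<lambda>y. 1 / sqrt (y\<^sup>2 + \<epsilon>)) has_real_derivative - y / ((y\<^sup>2 + \<epsilon>) * sqrt (y\<^sup>2 + \<epsilon>))) (at y)"
    using p[of y] by (auto intro!: derivative_eq_intros simp: field_simps power2_eq_square)
  show "continuous_on UNIV (\<lambda>y. - y / ((y\<^sup>2 + \<epsilon>) * sqrt (y\<^sup>2 + \<epsilon>)))"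
    using p by (intro continuous_intros) (auto simp: less_imp_neq[symmetric])
qed

theorem theorem4:
  fixes D :: "(real ^ 'n) set" and xs :: "real ^ 'n" and J :: "real ^ 'n \<Rightarrow> real"
    and \<phi>1 \<phi>2 \<psi>11 \<psi>12 \<psi>21 \<psi>22 :: "real \<Rightarrow> real"
    and \<epsilon> :: real and \<alpha> \<beta> :: "'n \<Rightarrow> real" and \<kappa> \<mu>1 \<mu>2 :: "'n \<Rightarrow> nat"
  assumes "open D" "connected D" "xs \<in> D"
    and "C2_on J D"
    and "\<And>x. x \<in> D - {xs} \<Longrightarrow> J x > J xs"
    and "\<And>x. x \<in> D \<Longrightarrow> GDERIV J x :> 0 \<longleftrightarrow> x = xs"
    and "C2_on \<phi>1 UNIV" "C2_on \<phi>2 UNIV"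
    and "C2_on \<psi>11 UNIV" "C2_on \<psi>12 UNIV" "C2_on \<psi>21 UNIV" "C2_on \<psi>22 UNIV"
    and "\<And>y. lie_bracket \<phi>1 \<phi>2 y = -1"
    and "\<And>y. \<psi>11 y * deriv \<psi>21 y + \<psi>12 y * deriv \<psi>22 y = 1"
    and "\<epsilon> > 0"
    and "\<And>i. \<alpha> i > 0" "\<And>i. \<beta> i > 0"
    and "\<And>i. \<kappa> i > 0" "\<And>i. \<mu>1 i > 0" "\<And>i. \<mu>2 i > 0"
    and "inj \<kappa>" "inj \<mu>1" "inj \<mu>2"
    and "range \<kappa> \<inter> range \<mu>1 = {}" "range \<kappa> \<inter> range \<mu>2 = {}" "range \<mu>1 \<inter> range \<mu>2 = {}"
  shows "practically_uniformly_asymptotically_stable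
           (es_field \<phi>1 \<phi>2 \<psi>11 \<psi>12 \<psi>21 \<psi>22 J \<epsilon> \<alpha> \<beta> \<kappa> \<mu>1 \<mu>2) (D \<times> UNIV) (xs, 0)"
proof -
  note J_min = assms(5) and grad_zero = assms(6) and bracket = assms(13) and \<psi> = assms(14) and \<epsilon> = assms(15)
    and pos_\<alpha>\<beta> = assms(16,17) and pos_freq = assms(18-20)
  define U :: "((real ^ 'n) \<times> (real ^ 'n)) set" where "U = D \<times> UNIV"
  have openU: "open U" using assms(1) by (simp add: U_def open_Times)
  obtain J' J'' where J: "C1_on J J' D" and J': "\<And>z. C1_on (\<lambda>x. J' x z) (J'' z) D"
    and J''_lin: "\<And>x z. linear (\<lambda>h. J'' h x z)"
    using C2_on_C1[OF assms(4)] by blast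
  have J''0: "J'' 0 x z = 0" for x z using linear_0[OF J''_lin] .
  define \<sigma> where "\<sigma> y = 1 / sqrt (y\<^sup>2 + \<epsilon>)" for y :: real
  define \<sigma>' where "\<sigma>' y = - y / ((y\<^sup>2 + \<epsilon>) * sqrt (y\<^sup>2 + \<epsilon>))" for y :: real
  have \<sigma>_pos: "\<sigma> y > 0" for y using \<epsilon> by (simp add: \<sigma>_def add_nonneg_pos)
  have lin_snd: "bounded_linear (\<lambda>q :: (real ^ 'n) \<times> (real ^ 'n). snd q $ i)" for i
    by (rule bounded_linear_compose[OF bounded_linear_vec_nth bounded_linear_snd])
  have C1_J: "C1_on (\<lambda>q. J (fst q)) (\<lambda>q h. J' (fst q) (fst h)) U"
    unfolding U_def by (rule C1_on_fst[OF J])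
  have C1_\<sigma>: "C1_on (\<lambda>q. \<sigma> (snd q $ i)) (\<lambda>q h. \<sigma>' (snd q $ i) * (snd h $ i)) U" for i
    using C1_on_compose_real[OF inverse_sqrt_C1[OF \<epsilon>] C1_on_linear[OF lin_snd]] by (simp add: \<sigma>_def \<sigma>'_def)
  define w where "w i q = J (fst q) * \<sigma> (snd q $ i)" for i and q :: "(real ^ 'n) \<times> (real ^ 'n)"
  define w' where "w' i q h = J (fst q) * (\<sigma>' (snd q $ i) * (snd h $ i)) + J' (fst q) (fst h) * \<sigma> (snd q $ i)"
    for i and q h :: "(real ^ 'n) \<times> (real ^ 'n)"
  have C1_w: "C1_on (w i) (w' i) U" for i
    unfolding w_def[abs_def] w'_def[abs_def] by (rule C1_on_mult[OF C1_J C1_\<sigma>])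
  \<comment> \<open>The amplitudes of the inputs without the common factor
    \<open>sqrt \<omega>\<close>. Their squares contain the respective frequency and cancel the
    divisor \<open>2 * real (m k)\<close>.\<close>
  define c1 c2 c3 where "c1 i = sqrt (2 * \<alpha> i * real (\<kappa> i))" and "c2 i = sqrt (2 * \<beta> i) * sqrt (real (\<mu>1 i))"
    and "c3 i = sqrt (2 * \<beta> i) * sqrt (real (\<mu>2 i))" for i
  \<comment> \<open>Each frequency carries one pair of fields \<open>u k *\<^sub>R d k\<close> (cosine) and \<open>v k *\<^sub>R e k\<close> (sine); the three
    summands of the index type belong to \<open>\<kappa>\<close>, \<open>\<mu>1\<close> and \<open>\<mu>2\<close>.\<close>
  define u where "u = case_sum (\<lambda>i q. c1 i * \<phi>1 (w i q))
    (case_sum (\<lambda>i q. c2 i * \<psi>11 (J (fst q))) (\<lambda>i q. c3 i * \<psi>12 (J (fst q))))"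
  define u' where "u' = case_sum (\<lambda>i q h. c1 i * (deriv \<phi>1 (w i q) * w' i q h))
    (case_sum (\<lambda>i q h. c2 i * (deriv \<psi>11 (J (fst q)) * J' (fst q) (fst h)))
      (\<lambda>i q h. c3 i * (deriv \<psi>12 (J (fst q)) * J' (fst q) (fst h))))"
  define v where "v = case_sum (\<lambda>i q. c1 i * \<phi>2 (w i q))
    (case_sum (\<lambda>i q. c2 i * \<psi>21 (J (fst q))) (\<lambda>i q. c3 i * \<psi>22 (J (fst q))))"
  define v' where "v' = case_sum (\<lambda>i q h. c1 i * (deriv \<phi>2 (w i q) * w' i q h))
    (case_sum (\<lambda>i q h. c2 i * (deriv \<psi>21 (J (fst q)) * J' (fst q) (fst h)))
      (\<lambda>i q h. c3 i * (deriv \<psi>22 (J (fst q)) * J' (fst q) (fst h))))"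
  define ex ev :: "'n \<Rightarrow> (real ^ 'n) \<times> (real ^ 'n)" where "ex i = (axis i 1, 0)" and "ev i = (0, axis i 1)" for i
  \<comment> \<open>Cosine fields always move \<open>x_i\<close>; sine fields move
    \<open>x_i\<close> for \<open>\<kappa>\<close> and \<open>v_i\<close> for \<open>\<mu>1\<close>
    and \<open>\<mu>2\<close>.\<close>
  define d where "d = case_sum ex (case_sum ex ex)"
  define e where "e = case_sum ex (case_sum ev ev)"
  define m where "m = case_sum \<kappa> (case_sum \<mu>1 \<mu>2)"
  have index_cases: "P k" if "\<And>i. P (Inl i)" "\<And>i. P (Inr (Inl i))" "\<And>i. P (Inr (Inr i))"
    for P :: "'n + 'n + 'n \<Rightarrow> bool" and k
    using that by (metis sum.exhaust)
  have C1_u: "C1_on (u k) (u' k) U" and C1_v: "C1_on (v k) (v' k) U" for k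
  proof -
    note C1 = C1_on_cmult[OF C1_on_compose_real[OF C2_on_real C1_w]] C1_on_cmult[OF C1_on_compose_real[OF C2_on_real C1_J]]
    show "C1_on (u k) (u' k) U"
      by (rule index_cases) (auto simp: u_def u'_def intro: C1 assms)
    show "C1_on (v k) (v' k) U"
      by (rule index_cases) (auto simp: v_def v'_def intro: C1 assms)
  qed
  define f0 where "f0 q = (0 :: real ^ 'n, \<chi> i. - \<beta> i * snd q $ i)" for q :: "(real ^ 'n) \<times> (real ^ 'n)"
  have "linear f0" by (intro linearI) (auto simp: f0_def vec_eq_iff algebra_simps)
  then have C1_f0: "C1_on f0 (\<lambda>_. f0) U" by (intro C1_on_linear linear_conv_bounded_linear[THEN iffD1])
  have field: "es_field \<phi>1 \<phi>2 \<psi>11 \<psi>12 \<psi>21 \<psi>22 J \<epsilon> \<alpha> \<beta> \<kappa> \<mu>1 \<mu>2 =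
      oscillating_field f0 (\<lambda>k q. u k q *\<^sub>R d k) (\<lambda>k q. v k q *\<^sub>R e k) m"
  proof (intro ext)
    fix \<omega> t and q :: "(real ^ 'n) \<times> (real ^ 'n)"
    have w_eq: "w i q = J (fst q) / sqrt ((snd q $ i)\<^sup>2 + \<epsilon>)" for i by (simp add: w_def \<sigma>_def)
    have "oscillating_field f0 (\<lambda>k q. u k q *\<^sub>R d k) (\<lambda>k q. v k q *\<^sub>R e k) m \<omega> t q = f0 q + sqrt \<omega> *\<^sub>R
      ((\<Sum>i\<in>UNIV. (cos (real (\<kappa> i) * \<omega> * t) * (c1 i * \<phi>1 (w i q)) + sin (real (\<kappa> i) * \<omega> * t) * (c1 i * \<phi>2 (w i q))) *\<^sub>R (axis i 1, 0 :: real ^ 'n)) +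
       ((\<Sum>i\<in>UNIV. (cos (real (\<mu>1 i) * \<omega> * t) * (c2 i * \<psi>11 (J (fst q)))) *\<^sub>R (axis i 1, 0 :: real ^ 'n)) +
        (\<Sum>i\<in>UNIV. (sin (real (\<mu>1 i) * \<omega> * t) * (c2 i * \<psi>21 (J (fst q)))) *\<^sub>R (0 :: real ^ 'n, axis i 1))) +
       ((\<Sum>i\<in>UNIV. (cos (real (\<mu>2 i) * \<omega> * t) * (c3 i * \<psi>12 (J (fst q)))) *\<^sub>R (axis i 1, 0 :: real ^ 'n)) +
        (\<Sum>i\<in>UNIV. (sin (real (\<mu>2 i) * \<omega> * t) * (c3 i * \<psi>22 (J (fst q)))) *\<^sub>R (0 :: real ^ 'n, axis i 1))))"
      unfolding oscillating_field_def sum_UNIV_sum_type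
      by (simp add: u_def v_def d_def e_def m_def ex_def ev_def scaleR_add_left sum.distrib add.assoc del: scaleR_Pair)
    also have "\<dots> = es_field \<phi>1 \<phi>2 \<psi>11 \<psi>12 \<psi>21 \<psi>22 J \<epsilon> \<alpha> \<beta> \<kappa> \<mu>1 \<mu>2 \<omega> t q"
      unfolding sum_scaleR_axis es_field_def
      by (auto simp: case_prod_beta f0_def vec_eq_iff c1_def c2_def c3_def w_eq real_sqrt_mult algebra_simps prod_eq_iff)
    finally show "es_field \<phi>1 \<phi>2 \<psi>11 \<psi>12 \<psi>21 \<psi>22 J \<epsilon> \<alpha> \<beta> \<kappa> \<mu>1 \<mu>2 \<omega> t q =
      oscillating_field f0 (\<lambda>k q. u k q *\<^sub>R d k) (\<lambda>k q. v k q *\<^sub>R e k) m \<omega> t q" by simp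
  qed
  \<comment> \<open>The weight for which \<open>2 * c i * \<beta> i \<le> \<alpha> i / sqrt (v\<^sup>2 + \<epsilon>)\<close> as long as \<open>\<bar>v\<bar> \<le> 1\<close>, so that the
    gradient terms absorb the cross terms.\<close>
  define c where "c i = \<alpha> i / (2 * \<beta> i * sqrt (1 + \<epsilon>))" for i
  have c_pos: "c i > 0" for i using pos_\<alpha>\<beta>[of i] \<epsilon> by (simp add: c_def)
  define V where "V q = J (fst q) + (\<Sum>i\<in>UNIV. c i * (snd q $ i * snd q $ i))" for q :: "(real ^ 'n) \<times> (real ^ 'n)"
  define V' where "V' q h = J' (fst q) (fst h) + (\<Sum>i\<in>UNIV. c i * (snd q $ i * snd h $ i + snd h $ i * snd q $ i))"
    for q h :: "(real ^ 'n) \<times> (real ^ 'n)"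
  define V'' where "V'' z q h = J'' (fst z) (fst q) (fst h) + (\<Sum>i\<in>UNIV. (2 * c i * snd z $ i) * snd h $ i)"
    for z q h :: "(real ^ 'n) \<times> (real ^ 'n)"
  have C1_V: "C1_on V V' U"
    unfolding V_def[abs_def] V'_def[abs_def]
    by (intro C1_on_add C1_J C1_on_sum C1_on_cmult C1_on_mult C1_on_linear lin_snd)
  have C1_V': "C1_on (\<lambda>q. V' q z) (V'' z) U" for z
  proof -
    have "C1_on (\<lambda>q. J' (fst q) (fst z) + (\<Sum>i\<in>UNIV. (2 * c i * snd z $ i) * snd q $ i)) (V'' z) U"
      unfolding V''_def[abs_def] U_def
      by (intro C1_on_add C1_on_sum C1_on_cmult C1_on_linear lin_snd C1_on_fst[OF J'])
    moreover have "V' q z = J' (fst q) (fst z) + (\<Sum>i\<in>UNIV. (2 * c i * snd z $ i) * snd q $ i)" for q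
      by (simp add: V'_def algebra_simps)
    ultimately show ?thesis by simp
  qed
  have J'0: "J' x 0 = 0" if "x \<in> D" for x using linear_0[OF C1_onD(3)[OF J that]] .
  have J''00: "J'' z x 0 = 0" if "x \<in> D" for x z using linear_0[OF C1_onD(3)[OF J' that]] .
  obtain r0 where r0: "r0 > 0" "cball (xs, 0) r0 \<subseteq> U"
    using openU[unfolded open_contains_cball, rule_format, of "(xs, 0)"] assms(3) by (auto simp: U_def)
  \<comment> \<open>Radius at most 1 guarantees \<open>\<bar>v\<bar> \<le> 1\<close> componentwise,
    the range for which the weights \<open>c i\<close> are made.\<close>
  define r where "r = min r0 1"
  have r: "r > 0" "cball (xs, 0) r \<subseteq> U" using r0 by (auto simp: r_def)
  show ?thesis
    unfolding field U_def[symmetric]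
  proof (rule oscillating_directional_field_practically_asymptotically_stable[OF openU r _ _ C1_f0 C1_u C1_v C1_V C1_V'])
    show "0 < m k" for k by (rule index_cases) (auto simp: m_def pos_freq)
    show "inj m"
    proof (rule injI)
      have distinct: "\<kappa> i \<noteq> \<mu>1 j" "\<kappa> i \<noteq> \<mu>2 j" "\<mu>1 i \<noteq> \<mu>2 j" for i j
        using assms(24-26) by blast+
      fix j k assume "m j = m k"
      then show "j = k"
        using assms(21-23) distinct distinct[symmetric] by (auto simp: m_def inj_eq split: sum.splits)
    qed
    \<comment> \<open>For \<open>\<kappa>\<close> the two directions are equal. Otherwise one has no
      \<open>x\<close> part and the other no \<open>v\<close> part, and both sides are 0.\<close>
    show "V'' (d k) q (e k) = V'' (e k) q (d k)" if "q \<in> U" for k q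
      by (rule index_cases[of _ k]) (use that in \<open>auto simp: d_def e_def V''_def ex_def ev_def J''0 J''00 U_def\<close>)
    show "V (xs, 0) < V q" if q: "q \<in> cball (xs, 0) r" "q \<noteq> (xs, 0)" for q
    proof -
      have nonneg: "c i * (snd q $ i * snd q $ i) \<ge> 0" for i using c_pos[of i] by simp
      then have sum_nonneg: "(\<Sum>i\<in>UNIV. c i * (snd q $ i * snd q $ i)) \<ge> 0" by (intro sum_nonneg)
      show ?thesis
      proof (cases "fst q = xs")
        case True
        then have "snd q \<noteq> 0" using q(2) by (auto simp: prod_eq_iff)
        then obtain i where "snd q $ i \<noteq> 0" by (auto simp: vec_eq_iff)
        then have "c i * (snd q $ i * snd q $ i) > 0" using c_pos[of i] by (auto simp: zero_less_mult_iff not_less le_less)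
        then have "(\<Sum>i\<in>UNIV. c i * (snd q $ i * snd q $ i)) > 0"
          using nonneg by (intro sum_pos2[of UNIV i]) auto
        then show ?thesis using True by (simp add: V_def)
      next
        case False
        then have "J xs < J (fst q)" using q r(2) by (intro J_min) (auto simp: U_def)
        then show ?thesis using sum_nonneg by (simp add: V_def)
      qed
    qed
    show "V' q (f0 q) + (\<Sum>k\<in>UNIV. (u k q * v' k q (d k) * V' q (e k) - v k q * u' k q (e k) * V' q (d k)) / (2 * real (m k))) < 0"
      if q: "q \<in> cball (xs, 0) r" "q \<noteq> (xs, 0)" for q
    proof -
      define x y where "x = fst q" and "y = snd q"
      define g where "g i = J' x (axis i 1)" for i
      have xD: "x \<in> D" using q r(2) by (auto simp: x_def U_def)
      have V'ex: "V' q (ex i) = g i" and V'ev: "V' q (ev i) = 2 * c i * y $ i" for i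
        using J'0[OF xD] by (auto simp: V'_def ex_def ev_def g_def x_def y_def axis_def if_distrib if_distribR cong: if_cong)
      have w'ex: "w' i q (ex i) = g i * \<sigma> (y $ i)" for i by (simp add: w'_def ex_def g_def x_def y_def)
      \<comment> \<open>Both fields point along \<open>x_i\<close>, so the bracket of
        \<open>\<phi>1\<close> and \<open>\<phi>2\<close> appears. One factor \<open>g i\<close>
        comes from differentiating \<open>J\<close> inside the input, the other from
        \<open>V\<close>.\<close>
      have t1: "(u (Inl i) q * v' (Inl i) q (d (Inl i)) * V' q (e (Inl i)) - v (Inl i) q * u' (Inl i) q (e (Inl i)) * V' q (d (Inl i)))
          / (2 * real (m (Inl i))) = - \<alpha> i * \<sigma> (y $ i) * (g i)\<^sup>2" for i
      proof -
        have "u (Inl i) q * v' (Inl i) q (d (Inl i)) * V' q (e (Inl i)) - v (Inl i) q * u' (Inl i) q (e (Inl i)) * V' q (d (Inl i))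
          = (c1 i)\<^sup>2 * lie_bracket \<phi>1 \<phi>2 (w i q) * \<sigma> (y $ i) * (g i)\<^sup>2"
          by (simp add: u_def v_def u'_def v'_def d_def e_def V'ex w'ex lie_bracket_def power2_eq_square algebra_simps)
        also have "\<dots> = - (2 * \<alpha> i * real (\<kappa> i)) * \<sigma> (y $ i) * (g i)\<^sup>2"
          using pos_\<alpha>\<beta>[of i] by (simp add: bracket c1_def)
        finally show ?thesis using pos_freq(1)[of i] by (simp add: m_def)
      qed
      \<comment> \<open>The subtracted half is zero: the cosine input depends on \<open>x\<close>
        only, and the sine direction has no \<open>x\<close> part.\<close>
      have t2: "(u (Inr (Inl i)) q * v' (Inr (Inl i)) q (d (Inr (Inl i))) * V' q (e (Inr (Inl i))) - v (Inr (Inl i)) q * u' (Inr (Inl i)) q (e (Inr (Inl i))) * V' q (d (Inr (Inl i))))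
          / (2 * real (m (Inr (Inl i)))) = \<psi>11 (J x) * deriv \<psi>21 (J x) * (2 * c i * \<beta> i * g i * y $ i)" for i
      proof -
        have "u (Inr (Inl i)) q * v' (Inr (Inl i)) q (d (Inr (Inl i))) * V' q (e (Inr (Inl i))) - v (Inr (Inl i)) q * u' (Inr (Inl i)) q (e (Inr (Inl i))) * V' q (d (Inr (Inl i)))
          = (c2 i)\<^sup>2 * \<psi>11 (J x) * deriv \<psi>21 (J x) * g i * (2 * c i * y $ i)"
          using J'0[OF xD]
          by (simp add: u_def v_def u'_def v'_def d_def e_def V'ex V'ev ex_def[of i] ev_def[of i] g_def x_def flip: V'ev)
            (simp add: V'ev[unfolded ev_def] power2_eq_square)
        also have "(c2 i)\<^sup>2 = 2 * \<beta> i * real (\<mu>1 i)"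
          using pos_\<alpha>\<beta>[of i] by (simp add: c2_def power_mult_distrib)
        finally show ?thesis using pos_freq(2)[of i] by (simp add: m_def)
      qed
      have t3: "(u (Inr (Inr i)) q * v' (Inr (Inr i)) q (d (Inr (Inr i))) * V' q (e (Inr (Inr i))) - v (Inr (Inr i)) q * u' (Inr (Inr i)) q (e (Inr (Inr i))) * V' q (d (Inr (Inr i))))
          / (2 * real (m (Inr (Inr i)))) = \<psi>12 (J x) * deriv \<psi>22 (J x) * (2 * c i * \<beta> i * g i * y $ i)" for i
      proof -
        have "u (Inr (Inr i)) q * v' (Inr (Inr i)) q (d (Inr (Inr i))) * V' q (e (Inr (Inr i))) - v (Inr (Inr i)) q * u' (Inr (Inr i)) q (e (Inr (Inr i))) * V' q (d (Inr (Inr i)))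
          = (c3 i)\<^sup>2 * \<psi>12 (J x) * deriv \<psi>22 (J x) * g i * (2 * c i * y $ i)"
          using J'0[OF xD]
          by (simp add: u_def v_def u'_def v'_def d_def e_def V'ex V'ev ex_def[of i] ev_def[of i] g_def x_def flip: V'ev)
            (simp add: V'ev[unfolded ev_def] power2_eq_square)
        also have "(c3 i)\<^sup>2 = 2 * \<beta> i * real (\<mu>2 i)"
          using pos_\<alpha>\<beta>[of i] by (simp add: c3_def power_mult_distrib)
        finally show ?thesis using pos_freq(3)[of i] by (simp add: m_def)
      qed
      \<comment> \<open>The pairs for \<open>\<mu>1\<close> and \<open>\<mu>2\<close> produce the
        same cross term, with weights that sum to 1.\<close>
      have t23: "\<psi>11 (J x) * deriv \<psi>21 (J x) * s + \<psi>12 (J x) * deriv \<psi>22 (J x) * s = s" for s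
        using \<psi>[of "J x"] by (simp flip: distrib_right)
      have "V' q (f0 q) = (\<Sum>i\<in>UNIV. - 2 * c i * \<beta> i * (y $ i)\<^sup>2)"
        using J'0[OF xD] by (simp add: V'_def f0_def x_def y_def power2_eq_square sum_negf algebra_simps)
      moreover have "(\<Sum>k\<in>UNIV. (u k q * v' k q (d k) * V' q (e k) - v k q * u' k q (e k) * V' q (d k)) / (2 * real (m k)))
          = (\<Sum>i\<in>UNIV. - \<alpha> i * \<sigma> (y $ i) * (g i)\<^sup>2) + (\<Sum>i\<in>UNIV. 2 * c i * \<beta> i * g i * y $ i)"
        unfolding sum_UNIV_sum_type t1 t2 t3 sum.distrib[symmetric] t23 by simp
      ultimately have eq: "V' q (f0 q) + (\<Sum>k\<in>UNIV. (u k q * v' k q (d k) * V' q (e k) - v k q * u' k q (e k) * V' q (d k)) / (2 * real (m k)))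
          = (\<Sum>i\<in>UNIV. - 2 * c i * \<beta> i * (y $ i)\<^sup>2 + (- \<alpha> i * \<sigma> (y $ i) * (g i)\<^sup>2 + 2 * c i * \<beta> i * g i * y $ i))"
        by (simp only: sum.distrib)
      \<comment> \<open>By the choice of \<open>c i\<close> the gradient term is at most
        \<open>- 2 * (c i * \<beta> i) * (g i)\<^sup>2\<close>. The bound then follows by completing
        the square: the slack is \<open>c i * \<beta> i * (y $ i - g i)\<^sup>2\<close>.\<close>
      have term_le: "- 2 * c i * \<beta> i * (y $ i)\<^sup>2 + (- \<alpha> i * \<sigma> (y $ i) * (g i)\<^sup>2 + 2 * c i * \<beta> i * g i * y $ i)
          \<le> - (c i * \<beta> i * ((y $ i)\<^sup>2 + (g i)\<^sup>2))" for i
      proof -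
        have "\<bar>y $ i\<bar> \<le> norm y" by (rule component_le_norm_cart)
        also have "\<dots> \<le> 1"
          using q(1) norm_snd_le[of "snd q" "fst q - xs"] norm_minus_commute[of "(xs, 0)" q]
          by (cases q) (auto simp: r_def y_def dist_norm)
        finally have "(y $ i)\<^sup>2 \<le> 1" by (simp add: abs_square_le_1)
        then have "sqrt ((y $ i)\<^sup>2 + \<epsilon>) \<le> sqrt (1 + \<epsilon>)" by simp
        then have "1 / sqrt (1 + \<epsilon>) \<le> \<sigma> (y $ i)"
          unfolding \<sigma>_def using \<epsilon> by (intro divide_left_mono) (auto simp: add_nonneg_pos)
        then have "\<alpha> i * (1 / sqrt (1 + \<epsilon>)) \<le> \<alpha> i * \<sigma> (y $ i)"
          using pos_\<alpha>\<beta>[of i] by (intro mult_left_mono) auto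
        moreover have "\<alpha> i * (1 / sqrt (1 + \<epsilon>)) = 2 * (c i * \<beta> i)"
          using pos_\<alpha>\<beta>[of i] by (simp add: c_def)
        ultimately have "2 * (c i * \<beta> i) * (g i)\<^sup>2 \<le> \<alpha> i * \<sigma> (y $ i) * (g i)\<^sup>2"
          by (intro mult_right_mono) auto
        moreover have "c i * \<beta> i * (y $ i - g i)\<^sup>2 \<ge> 0"
          using c_pos[of i] pos_\<alpha>\<beta>[of i] by simp
        ultimately show ?thesis by (simp add: power2_eq_square algebra_simps)
      qed
      have term_nonneg: "c i * \<beta> i * ((y $ i)\<^sup>2 + (g i)\<^sup>2) \<ge> 0" for i
        using c_pos[of i] pos_\<alpha>\<beta>[of i] by simp
      \<comment> \<open>The estimate is strict unless \<open>y\<close> and the gradient of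
        \<open>J\<close> both vanish, and then the hypothesis on critical points puts the state at
        the equilibrium.\<close>
      have "\<exists>i. y $ i \<noteq> 0 \<or> g i \<noteq> 0"
      proof (rule ccontr)
        assume "\<not> ?thesis"
        then have yg: "y = 0" "\<And>i. g i = 0" by (auto simp: vec_eq_iff)
        have lin: "linear (J' x)" by (rule C1_onD(3)[OF J xD])
        have "J' x h = 0" for h
        proof -
          have "J' x h = J' x (\<Sum>i\<in>UNIV. h $ i *\<^sub>R axis i 1)"
            using basis_expansion[of h] by (simp add: scalar_mult_eq_scaleR)
          also have "\<dots> = 0" using yg(2) by (simp add: linear_sum[OF lin] linear_scale[OF lin] flip: g_def)
          finally show ?thesis .
        qed
        then have "J' x = (\<lambda>_. 0)" by blast
        then have "GDERIV J x :> 0"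
          using C1_onD(1)[OF J xD] by (simp add: gderiv_def)
        then have "x = xs" using grad_zero[OF xD] by simp
        then show False using q(2) yg(1) by (simp add: x_def y_def prod_eq_iff)
      qed
      then obtain i where "y $ i \<noteq> 0 \<or> g i \<noteq> 0" by blast
      then have "(y $ i)\<^sup>2 + (g i)\<^sup>2 > 0" by (simp add: sum_power2_gt_zero_iff)
      then have "c i * \<beta> i * ((y $ i)\<^sup>2 + (g i)\<^sup>2) > 0" using c_pos[of i] pos_\<alpha>\<beta>[of i] by simp
      then have "(\<Sum>i\<in>UNIV. c i * \<beta> i * ((y $ i)\<^sup>2 + (g i)\<^sup>2)) > 0"
        using term_nonneg by (intro sum_pos2[of UNIV i]) auto
      moreover have "(\<Sum>i\<in>UNIV. - 2 * c i * \<beta> i * (y $ i)\<^sup>2 + (- \<alpha> i * \<sigma> (y $ i) * (g i)\<^sup>2 + 2 * c i * \<beta> i * g i * y $ i))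
          \<le> (\<Sum>i\<in>UNIV. - (c i * \<beta> i * ((y $ i)\<^sup>2 + (g i)\<^sup>2)))"
        by (intro sum_mono term_le)
      ultimately show ?thesis unfolding eq by (simp add: sum_negf)
    qed
  qed
qed

end
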